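(* Let $n\ge1$ and $p\in\{0,1,2,\dots\}\cup\{+\infty\}$. 1. The set of functions in $C^p(\mathbb{T}^n)$ that are holomorphically extendable from one side in the separately continuous sense at no point of $\mathbb{T}^n$ is a dense $G_\delta$ subset of $C^p(\mathbb{T}^n)$. 2. The set of functions in $C^p(\mathbb{T}^n)$ that are holomorphically extendable from one side (in the usual sense) at no point of $\mathbb{T}^n$ is residual in $C^p(\mathbb{T}^n)$, i.e. it contains a dense $G_\delta$ subset. 3. The set of functions in $C^p(\mathbb{T}^n)$ that are holomorphically extendable from one side in the Lipschitz continuous sense at no point of $\mathbb{T}^n$ is a dense $G_\delta$ subset of $C^p(\mathbb{T}^n)$.
   Context: $D$ is the open unit disc and $\mathbb{T}$ the unit circle in $\mathbb{C}$. $C^p(\mathbb{T}^n)$ is the space of functions $f:\mathbb{T}^n\to\mathbb{C}$ whose derivatives $\frac{\partial^{\alpha}f}{\partial\theta^{\alpha}}(e^{i\theta_1},\dots,e^{i\theta_n})$ with respect to $\theta_1,\dots,\theta_n$ exist and are continuous on $\mathbb{T}^n$ for all multi-indices $|\alpha|\le p$ (all $\alpha$ if $p=+\infty$), with the topology given by the seminorms $|f|_\alpha=\sup_{\theta_i\in\mathbb{R}}\left|\frac{\partial^{\alpha}f}{\partial\theta^{\alpha}}(e^{i\theta_1},\dots,e^{i\theta_n})\right|$, $|\alpha|\le p$. A function $f:\mathbb{T}^n\to\mathbb{C}$ is holomorphically extendable from one side (usual sense) at $z\in\mathbb{T}^n$ if there are an open neighborhood $U\subseteq\mathbb{C}^n$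 of $z$ and a continuous function $F:\overline{U\cap D^n}\to\mathbb{C}$ that is holomorphic on $U\cap D^n$ and agrees with $f$ on $\mathbb{T}^n\cap\overline{U\cap D^n}$. In the separately continuous sense, the continuity of $F$ is relaxed to: $F$ is bounded and separately continuous, i.e. continuous in each complex variable when the other variables are fixed. In the Lipschitz continuous sense, the continuity of $F$ is strengthened to Lipschitz continuity of $F$. *)

theory Defs
  imports "HOL-Analysis.Analysis" "HOL-Library.Extended_Nat"
begin

text \<open>
  \<open>\<complex>\<^sup>n\<close> is \<open>complex^'n\<close>, with \<open>n = CARD('n) \<ge> 1\<close> arbitrary.
\<close>

definition torus :: "(complex^'n) set" where
  "torus = {z. \<forall>i. norm (z $ i) = 1}"

definition polydisc :: "(complex^'n) set" where
  "polydisc = {z. \<forall>i. norm (z $ i) < 1}"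

definition set_coord :: "'n \<Rightarrow> complex \<Rightarrow> complex^'n \<Rightarrow> complex^'n" where
  "set_coord i c z = (\<chi> j. if j = i then c else z $ j)"


section \<open>The spaces of p times continuously differentiable functions on the torus\<close>

text \<open>
  If \<open>z = (cis \<theta>\<^sub>1, \<dots>, cis \<theta>\<^sub>n)\<close>, then \<open>rotate_coord j t z\<close> is the point of the torus
  obtained by replacing \<open>\<theta>\<^sub>j\<close> by \<open>\<theta>\<^sub>j + t\<close>. Hence \<open>partial_theta j f z\<close> below is the value at
  \<open>\<theta>\<close> of the partial derivative of \<open>f (cis \<theta>\<^sub>1, \<dots>, cis \<theta>\<^sub>n)\<close> with respect to \<open>\<theta>\<^sub>j\<close>.
\<close>

definition rotate_coord :: "'n \<Rightarrow> real \<Rightarrow> complex^'n \<Rightarrow> complex^'n" where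
  "rotate_coord j t z = set_coord j (cis t * z $ j) z"

definition partial_theta :: "'n \<Rightarrow> (complex^'n \<Rightarrow> complex) \<Rightarrow> complex^'n \<Rightarrow> complex" where
  "partial_theta j f z = vector_derivative (\<lambda>t. f (rotate_coord j t z)) (at 0)"

text \<open>
  A derivative of order \<open>k\<close> is indexed by the list of the \<open>k\<close> coordinates of differentiation.
  The list \<open>js\<close> represents the multi-index \<open>\<alpha>\<close> with \<open>\<alpha>\<^sub>j = count_list js j\<close>, so
  \<open>\<bar>\<alpha>\<bar> = length js\<close>. Lists that differ in the order only give the same derivative of a function
  all of whose derivatives of order at most \<open>\<bar>\<alpha>\<bar>\<close> are continuous.
\<close>

definition iter_partial :: "'n list \<Rightarrow> (complex^'n \<Rightarrow> complex) \<Rightarrow> complex^'n \<Rightarrow> complex" where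
  "iter_partial js f = foldr partial_theta js f"

text \<open>\<open>vector_derivative\<close> is a total function, so existence is a separate condition.\<close>

primrec iter_partial_exists :: "'n list \<Rightarrow> (complex^'n \<Rightarrow> complex) \<Rightarrow> bool" where
  "iter_partial_exists [] f \<longleftrightarrow> True"
| "iter_partial_exists (j # js) f \<longleftrightarrow> iter_partial_exists js f \<and>
     (\<forall>z\<in>torus. (\<lambda>t. iter_partial js f (rotate_coord j t z)) differentiable (at (0::real)))"

text \<open>
  Functions on the torus are functions on \<open>complex^'n\<close> that are \<open>undefined\<close> off the torus.
\<close>

definition Cp :: "enat \<Rightarrow> (complex^'n \<Rightarrow> complex) set" where
  "Cp p = {f \<in> extensional torus.
     \<forall>js. enat (length js) \<le> p \<longrightarrow>
       iter_partial_exists js f \<and> continuous_on torus (iter_partial js f)}"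

definition Cp_seminorm :: "'n list \<Rightarrow> (complex^'n \<Rightarrow> complex) \<Rightarrow> real" where
  "Cp_seminorm js f = (SUP z\<in>torus. norm (iter_partial js f z))"

definition Cp_topology :: "enat \<Rightarrow> (complex^'n \<Rightarrow> complex) topology" where
  "Cp_topology p = topology_generated_by
     {{f \<in> Cp p. Cp_seminorm js (\<lambda>z. f z - g z) < e} | g js e.
        g \<in> Cp p \<and> enat (length js) \<le> p \<and> e > 0}"

lemma topspace_Cp_topology [simp]:
  "topspace (Cp_topology p) = (Cp p :: (complex^'n \<Rightarrow> complex) set)"
proof -
  have "(\<chi> i. 1) \<in> (torus :: (complex^'n) set)"
    by (simp add: torus_def)
  then have ne: "(torus :: (complex^'n) set) \<noteq> {}"
    by blast
  have zero: "Cp_seminorm [] (\<lambda>z. f z - f z) = 0" for f :: "complex^'n \<Rightarrow> complex"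
    using ne by (simp add: Cp_seminorm_def iter_partial_def)
  have "f \<in> topspace (Cp_topology p)" if f: "f \<in> Cp p" for f :: "complex^'n \<Rightarrow> complex"
  proof -
    let ?B = "{h \<in> Cp p. Cp_seminorm [] (\<lambda>z. h z - f z) < 1}"
    have "f \<in> ?B"
      using f zero by simp
    moreover have "\<exists>g js e. ?B = {h \<in> Cp p. Cp_seminorm js (\<lambda>z. h z - g z) < e} \<and>
        g \<in> Cp p \<and> enat (length js) \<le> p \<and> e > 0"
      by (rule exI[of _ f], rule exI[of _ "[]"], rule exI[of _ 1])
         (use f in \<open>simp add: zero_enat_def[symmetric]\<close>)
    ultimately show ?thesis
      unfolding Cp_topology_def topology_generated_by_topspace by blast
  qed
  moreover have "topspace (Cp_topology p) \<subseteq> (Cp p :: (complex^'n \<Rightarrow> complex) set)"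
    unfolding Cp_topology_def topology_generated_by_topspace by blast
  ultimately show ?thesis
    by blast
qed


section \<open>One-sided holomorphic extendability\<close>

text \<open>Complex differentiability on an open set: the derivative is complex linear.\<close>

definition holomorphic_several :: "(complex^'n \<Rightarrow> complex) \<Rightarrow> (complex^'n) set \<Rightarrow> bool" where
  "holomorphic_several F S \<longleftrightarrow>
     (\<forall>w\<in>S. \<exists>L. (F has_derivative L) (at w) \<and> (\<forall>c v. L (c *s v) = c * L v))"

text \<open>The parameter \<open>R\<close> is the regularity required of the extension \<open>F\<close> on its domain.\<close>

definition one_side_extendable ::
  "((complex^'n) set \<Rightarrow> (complex^'n \<Rightarrow> complex) \<Rightarrow> bool) \<Rightarrow>
   (complex^'n \<Rightarrow> complex) \<Rightarrow> complex^'n \<Rightarrow> bool" where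
  "one_side_extendable R f z \<longleftrightarrow>
     (\<exists>U F. open U \<and> z \<in> U \<and>
        R (closure (U \<inter> polydisc)) F \<and>
        holomorphic_several F (U \<inter> polydisc) \<and>
        (\<forall>w \<in> torus \<inter> closure (U \<inter> polydisc). F w = f w))"

definition bounded_separately_continuous ::
  "(complex^'n) set \<Rightarrow> (complex^'n \<Rightarrow> complex) \<Rightarrow> bool" where
  "bounded_separately_continuous S F \<longleftrightarrow> bounded (F ` S) \<and>
     (\<forall>w\<in>S. \<forall>i. continuous_on {c. set_coord i c w \<in> S} (\<lambda>c. F (set_coord i c w)))"

definition lipschitz_continuous ::
  "(complex^'n) set \<Rightarrow> (complex^'n \<Rightarrow> complex) \<Rightarrow> bool" where
  "lipschitz_continuous S F \<longleftrightarrow> (\<exists>L. L-lipschitz_on S F)"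

definition nowhere_extendable ::
  "((complex^'n) set \<Rightarrow> (complex^'n \<Rightarrow> complex) \<Rightarrow> bool) \<Rightarrow> enat \<Rightarrow>
   (complex^'n \<Rightarrow> complex) set" where
  "nowhere_extendable R p = {f \<in> Cp p. \<forall>z\<in>torus. \<not> one_side_extendable R f z}"


section \<open>Genericity\<close>

definition dense_gdelta_in :: "'a topology \<Rightarrow> 'a set \<Rightarrow> bool" where
  "dense_gdelta_in X S \<longleftrightarrow> gdelta_in X S \<and> X closure_of S = topspace X"

definition residual_in :: "'a topology \<Rightarrow> 'a set \<Rightarrow> bool" where
  "residual_in X S \<longleftrightarrow> S \<subseteq> topspace X \<and> (\<exists>G. dense_gdelta_in X G \<and> G \<subseteq> S)"

end

theory Submission
  imports Defs "HOL-Complex_Analysis.Complex_Analysis" "HOL-Real_Asymp.Real_Asymp"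
begin

text \<open>
  Both \<open>G\<^sub>\<delta>\<close> claims and the density rest on one stability estimate and one explicit function.

  \<^bold>\<open>Stability.\<close> For \<open>a\<close> on the torus and \<open>c < 1\<close> close to \<open>1\<close>, the points \<open>w\<close> of the polydisc with
  \<open>Re (w\<^sub>i cnj a\<^sub>i) > c\<close> for all \<open>i\<close> form a product of circular caps that shrinks to \<open>a\<close> as \<open>c\<close> tends
  to \<open>1\<close>. Let \<open>F\<close> be bounded by \<open>M\<close> and separately continuous on the closed product, and holomorphic
  inside. If \<open>F\<close> is small on the torus, then \<open>F\<close> is small on every smaller closed product of caps:
  with one variable this is the maximum principle for \<open>F(s) exp (t s cnj a)\<close> with \<open>t\<close> large
  (\<open>two_constants_on_cap\<close>), and with several variables one moves the coordinates from the circle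
  into the cap one at a time (\<open>small_on_torus_imp_small\<close>). The latter needs that slices in one
  variable are holomorphic even if the other coordinates lie on the boundary
  (\<open>slice_holomorphic\<close>). Hence, if functions \<open>f\<^sub>k\<close> with extensions of a common bound converge to \<open>f\<close>
  uniformly on the torus, the extensions converge uniformly on a smaller product of caps, and the
  limit extends \<open>f\<close>.

  \<^bold>\<open>\<open>G\<^sub>\<delta>\<close>.\<close> Let \<open>E\<^sub>M\<^sub>,\<^sub>B\<close> be the set of functions with an extension over the basic open set \<open>B\<close> with
  bound (and Lipschitz constant, in the third case) \<open>M\<close>. By stability, the closure of \<open>E\<^sub>M\<^sub>,\<^sub>B\<close> consists
  of functions that are extendable at all points of the torus in \<open>B\<close>. The extendable functions are
  therefore the union of the countably many closures of the sets \<open>E\<^sub>M\<^sub>,\<^sub>B\<close> with \<open>M\<close> a natural number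
  and \<open>B\<close> in a countable basis (\<open>gdelta_nowhere_extendable\<close>).

  \<^bold>\<open>Density.\<close> Suppose that \<open>h\<close> in \<open>C\<^sup>p\<close> is nowhere extendable. For any \<open>f\<close> the line \<open>f + t h\<close> is
  continuous in \<open>t\<close>. If \<open>f + t h\<close> were extendable somewhere for each \<open>t\<close> of an interval, then,
  as the interval is uncountable, two different \<open>t\<close> would share a basic open set over
  which their functions extend, and \<open>h\<close>, a multiple of the difference of the two, would extend there
  as well. So nowhere extendable functions occur on the line arbitrarily close to \<open>f\<close>
  (\<open>dense_nowhere_extendable\<close>). Only the weakest kind of extension has to be considered: on the compact
  closure of \<open>U \<inter> D\<^sup>n\<close>, Lipschitz functions are continuous, and continuous functions are bounded and
  separately continuous. So the functions that are nowhere extendable in the separately continuous sense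
  form a dense \<open>G\<^sub>\<delta>\<close> inside each of the other two sets.

  \<^bold>\<open>The function.\<close> Take \<open>h(z) = \<Sum>\<^sub>k (cnj z\<^sub>i)\<^bsup>2^k\<^esup> / k!\<close> for a fixed \<open>i\<close>. It is smooth since
  \<open>\<Sum>\<^sub>k 2\<^bsup>k p\<^esup> / k!\<close> is finite for all \<open>p\<close>. The series also defines a holomorphic function of \<open>1 / z\<^sub>i\<close>
  outside of the disc. Thus an extension into the disc glues with it to a holomorphic function
  across an arc, whose derivatives are bounded by Cauchy's inequality. At dyadic angles
  all but finitely many terms of the series for the derivative have the same argument, and the derivatives
  grow too fast (\<open>lacunary_not_extendable_on_cap\<close>).
\<close>

section \<open>A two-constants estimate on caps of the unit disc\<close>

definition cap :: "complex \<Rightarrow> real \<Rightarrow> complex set" where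
  "cap a c = {s. norm s < 1 \<and> c < a \<bullet> s}"

definition closed_cap :: "complex \<Rightarrow> real \<Rightarrow> complex set" where
  "closed_cap a c = {s. norm s \<le> 1 \<and> c \<le> a \<bullet> s}"

lemma cap_eq_Int: "cap a c = ball 0 1 \<inter> {s. a \<bullet> s > c}"
  by (auto simp: cap_def)

lemma closed_cap_eq_Int: "closed_cap a c = cball 0 1 \<inter> {s. a \<bullet> s \<ge> c}"
  by (auto simp: closed_cap_def)

lemma open_cap: "open (cap a c)"
  unfolding cap_eq_Int by (intro open_Int open_ball open_halfspace_gt)

lemma closed_closed_cap: "closed (closed_cap a c)"
  unfolding closed_cap_eq_Int by (intro closed_Int closed_cball closed_halfspace_ge)

lemma cap_subset_closed_cap: "cap a c \<subseteq> closed_cap a c"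
  by (auto simp: cap_def closed_cap_def)

lemma closed_cap_mono: "c \<le> c' \<Longrightarrow> closed_cap a c' \<subseteq> closed_cap a c"
  by (auto simp: closed_cap_def)

lemma interior_closed_cap:
  assumes "a \<noteq> 0"
  shows "interior (closed_cap a c) = cap a c"
  unfolding closed_cap_eq_Int cap_eq_Int using assms by simp

lemma inner_le_1:
  fixes a s :: complex
  assumes "norm a = 1" "norm s \<le> 1"
  shows "a \<bullet> s \<le> 1"
  using norm_cauchy_schwarz[of a s] assms by simp

text \<open>
  A closed cap is star-shaped about a point of the open cap, in the strong sense that the half-open
  segments towards this point lie in the open cap. Boundary points of caps are approximated this way.
\<close>

lemma cap_interpolate:
  assumes a: "norm a = 1" and c: "0 < c" "c < 1" and s: "s \<in> closed_cap a c" and t: "0 < t" "t \<le> 1"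
  shows "(1 - t) *\<^sub>R s + t *\<^sub>R (((1 + c) / 2) *\<^sub>R a) \<in> cap a c"
proof -
  have n: "norm s \<le> 1" and i: "c \<le> a \<bullet> s"
    using s by (auto simp: closed_cap_def)
  have aa: "a \<bullet> a = 1"
    using a by (simp add: dot_square_norm)
  have "norm ((1 - t) *\<^sub>R s + t *\<^sub>R (((1 + c) / 2) *\<^sub>R a)) \<le> (1 - t) * norm s + t * ((1 + c) / 2)"
    by (rule order_trans[OF norm_triangle_ineq]) (use a t c in simp)
  also have "\<dots> \<le> (1 - t) * 1 + t * ((1 + c) / 2)"
    using n t by (intro add_right_mono mult_left_mono) auto
  also have "\<dots> < 1"
    using t c by (simp add: field_simps)
  finally have 1: "norm ((1 - t) *\<^sub>R s + t *\<^sub>R (((1 + c) / 2) *\<^sub>R a)) < 1" .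
  have "c < (1 - t) * c + t * ((1 + c) / 2)"
    using t c by (simp add: field_simps)
  also have "\<dots> \<le> (1 - t) * (a \<bullet> s) + t * ((1 + c) / 2)"
    using i t by (intro add_right_mono mult_left_mono) auto
  also have "\<dots> = a \<bullet> ((1 - t) *\<^sub>R s + t *\<^sub>R (((1 + c) / 2) *\<^sub>R a))"
    using aa by (simp add: inner_add_right)
  finally show ?thesis
    using 1 by (simp add: cap_def)
qed

text \<open>
  On the cap \<open>\<bar>exp (t s cnj a)\<bar> = exp (t (a \<bullet> s))\<close>, which is at most \<open>exp (t c)\<close> on the chord, at most \<open>exp t\<close>
  on the arc, and at least \<open>exp (t c')\<close> on the smaller cap. The maximum principle for
  \<open>\<phi>(s) exp (t s cnj a)\<close> thus gives \<open>\<bar>\<phi>\<bar> \<le> max (M exp (- t (c' - c))) (\<epsilon> exp (t (1 - c')))\<close> on the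
  smaller cap. One chooses first \<open>t\<close> large and then \<open>\<epsilon>\<close> small.
\<close>

lemma two_constants_on_cap:
  fixes M :: real
  assumes a: "norm a = 1" and c: "c < c'" and \<eta>: "0 < \<eta>"
  obtains \<epsilon> where "0 < \<epsilon>"
    "\<And>\<phi> s. \<lbrakk>continuous_on (closed_cap a c) \<phi>; \<phi> holomorphic_on cap a c;
      \<And>s. s \<in> closed_cap a c \<Longrightarrow> norm (\<phi> s) \<le> M;
      \<And>s. s \<in> closed_cap a c \<Longrightarrow> norm s = 1 \<Longrightarrow> norm (\<phi> s) \<le> \<epsilon>;
      s \<in> closed_cap a c'\<rbrakk> \<Longrightarrow> norm (\<phi> s) \<le> \<eta>"
proof -
  define K where "K = \<bar>M\<bar> + 1"
  \<comment> \<open>By \<open>exp x \<ge> x\<close> this \<open>t\<close> is large enough for \<open>K exp (- t (c' - c)) \<le> \<eta>\<close>.\<close>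
  define t where "t = K / \<eta> / (c' - c)"
  have K: "0 < K" "M \<le> K"
    by (auto simp: K_def)
  have t: "0 < t"
    using K \<eta> c by (simp add: t_def)
  have "t * (c' - c) = K / \<eta>"
    using c by (simp add: t_def)
  then have "1 + K / \<eta> \<le> exp (t * (c' - c))"
    by (metis exp_ge_add_one_self)
  then have "K / \<eta> \<le> exp (t * (c' - c))"
    by linarith
  then have "K \<le> \<eta> * exp (t * (c' - c))"
    using \<eta> by (simp add: field_simps)
  then have "K * exp (t * c) \<le> \<eta> * exp (t * (c' - c)) * exp (t * c)"
    by (intro mult_right_mono) auto
  then have chord: "K * exp (t * c) \<le> \<eta> * exp (t * c')"
    by (simp add: mult.assoc exp_add[symmetric] algebra_simps)
  define \<epsilon> where "\<epsilon> = \<eta> * exp (t * c' - t)"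
  have arc: "\<epsilon> * exp t = \<eta> * exp (t * c')"
    by (simp add: \<epsilon>_def mult.assoc exp_add[symmetric])
  have a0: "a \<noteq> 0"
    using a by auto
  show ?thesis
  proof (rule that)
    show "0 < \<epsilon>"
      using \<eta> by (simp add: \<epsilon>_def)
    fix \<phi> s0
    assume cont: "continuous_on (closed_cap a c) \<phi>" and hol: "\<phi> holomorphic_on cap a c"
      and M: "\<And>s. s \<in> closed_cap a c \<Longrightarrow> norm (\<phi> s) \<le> M"
      and small: "\<And>s. s \<in> closed_cap a c \<Longrightarrow> norm s = 1 \<Longrightarrow> norm (\<phi> s) \<le> \<epsilon>"
      and s0: "s0 \<in> closed_cap a c'"
    define \<psi> where "\<psi> s = \<phi> s * exp (of_real t * (s * cnj a))" for s
    have n\<psi>: "norm (\<psi> s) = norm (\<phi> s) * exp (t * (a \<bullet> s))" for s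
    proof -
      have "Re (s * cnj a) = a \<bullet> s"
        by (simp add: inner_complex_def algebra_simps)
      then show ?thesis
        by (simp add: \<psi>_def norm_mult)
    qed
    have "norm (\<psi> s0) \<le> \<eta> * exp (t * c')"
    proof (rule maximum_modulus_frontier[where S = "closed_cap a c" and f = \<psi>])
      show "\<psi> holomorphic_on interior (closed_cap a c)"
        unfolding interior_closed_cap[OF a0] \<psi>_def by (intro holomorphic_intros hol)
      show "continuous_on (closure (closed_cap a c)) \<psi>"
        unfolding closure_closed[OF closed_closed_cap] \<psi>_def by (intro continuous_intros cont)
      show "bounded (closed_cap a c)"
        unfolding closed_cap_eq_Int by (intro bounded_Int disjI1 bounded_cball)
      show "s0 \<in> closed_cap a c"
        using s0 closed_cap_mono c by (meson less_imp_le subsetD)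
      fix s
      assume "s \<in> frontier (closed_cap a c)"
      then have s: "s \<in> closed_cap a c" and "s \<notin> cap a c"
        by (auto simp: frontier_def interior_closed_cap[OF a0] closure_closed[OF closed_closed_cap])
      then consider "norm s = 1" | "a \<bullet> s = c"
        by (auto simp: cap_def closed_cap_def)
      then show "norm (\<psi> s) \<le> \<eta> * exp (t * c')"
      proof cases
        case 1
        have "norm (\<psi> s) \<le> \<epsilon> * exp t"
          unfolding n\<psi> using small[OF s 1] inner_le_1[OF a, of s] 1 t
          by (intro mult_mono) (auto intro: order_trans[OF norm_ge_zero])
        then show ?thesis
          using arc by simp
      next
        case 2
        have "norm (\<psi> s) \<le> K * exp (t * c)"
          unfolding n\<psi> 2 using M[OF s] K by (intro mult_right_mono) auto
        then show ?thesis
          using chord by simp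
      qed
    qed
    also have "\<dots> \<le> \<eta> * exp (t * (a \<bullet> s0))"
      using s0 t \<eta> by (auto simp: closed_cap_def)
    finally show "norm (\<phi> s0) \<le> \<eta>"
      unfolding n\<psi> by simp
  qed
qed

section \<open>Products of caps\<close>

text \<open>
  The open set \<open>halfspaces a c\<close> cuts the product of caps \<open>polycap a c\<close> out of the polydisc, so it
  serves as the neighbourhood \<open>U\<close> in the definition of extendability.
\<close>

definition halfspaces :: "complex^'n \<Rightarrow> real \<Rightarrow> (complex^'n) set" where
  "halfspaces a c = {w. \<forall>i. c < a $ i \<bullet> w $ i}"

definition polycap :: "complex^'n \<Rightarrow> real \<Rightarrow> (complex^'n) set" where
  "polycap a c = {w. \<forall>i. w $ i \<in> cap (a $ i) c}"

definition closed_polycap :: "complex^'n \<Rightarrow> real \<Rightarrow> (complex^'n) set" where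
  "closed_polycap a c = {w. \<forall>i. w $ i \<in> closed_cap (a $ i) c}"

lemma halfspaces_Int_polydisc: "halfspaces a c \<inter> polydisc = polycap a c"
  by (auto simp: halfspaces_def polycap_def polydisc_def cap_def)

lemma open_halfspaces: "open (halfspaces a c)"
proof -
  have "halfspaces a c = (\<Inter>i. {w. c < a $ i \<bullet> w $ i})"
    by (auto simp: halfspaces_def)
  moreover have "open {w. c < a $ i \<bullet> w $ i}" for i
    by (intro open_Collect_less continuous_intros)
  ultimately show ?thesis
    by (auto intro: open_INT)
qed

lemma open_polydisc: "open (polydisc :: (complex^'n) set)"
proof -
  have eq: "polydisc = (\<Inter>i. {w :: complex^'n. norm (w $ i) < 1})"
    by (auto simp: polydisc_def)
  show ?thesis
    unfolding eq by (intro open_INT finite ballI open_Collect_less continuous_intros)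
qed

lemma open_polycap: "open (polycap a c)"
  unfolding halfspaces_Int_polydisc[symmetric] by (intro open_Int open_halfspaces open_polydisc)

lemma polycap_subset_closed_polycap: "polycap a c \<subseteq> closed_polycap a c"
  using cap_subset_closed_cap by (auto simp: polycap_def closed_polycap_def)

lemma closed_polycap_mono: "c \<le> c' \<Longrightarrow> closed_polycap a c' \<subseteq> closed_polycap a c"
  using closed_cap_mono by (fastforce simp: closed_polycap_def)

lemma closed_closed_polycap: "closed (closed_polycap a c)"
proof -
  have "closed_polycap a c = (\<Inter>i. {w. norm (w $ i) \<le> 1} \<inter> {w. c \<le> a $ i \<bullet> w $ i})"
    by (auto simp: closed_polycap_def closed_cap_def)
  moreover have "closed ({w. norm (w $ i) \<le> 1} \<inter> {w. c \<le> a $ i \<bullet> w $ i})" for i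
    by (intro closed_Int closed_Collect_le continuous_intros)
  ultimately show ?thesis
    by (auto intro: closed_INT)
qed

lemma closure_polycap:
  assumes a: "a \<in> torus" and c: "0 < c" "c < 1"
  shows "closure (polycap a c) = closed_polycap a c"
proof
  show "closure (polycap a c) \<subseteq> closed_polycap a c"
    by (rule closure_minimal[OF polycap_subset_closed_polycap closed_closed_polycap])
  show "closed_polycap a c \<subseteq> closure (polycap a c)"
  proof
    fix w assume w: "w \<in> closed_polycap a c"
    define b where "b = ((1 + c) / 2) *\<^sub>R a"
    define x where "x k = (1 - 1 / real (Suc k)) *\<^sub>R w + (1 / real (Suc k)) *\<^sub>R b" for k
    have "x k \<in> polycap a c" for k
    proof -
      have "x k $ i \<in> cap (a $ i) c" for i
        unfolding x_def b_def vector_add_component vector_scaleR_component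
        using a w c by (intro cap_interpolate) (auto simp: torus_def closed_polycap_def)
      then show ?thesis
        by (simp add: polycap_def)
    qed
    moreover have "x \<longlonglongrightarrow> (1 - 0) *\<^sub>R w + 0 *\<^sub>R b"
      unfolding x_def by (intro tendsto_intros LIMSEQ_Suc[OF lim_1_over_n])
    ultimately show "w \<in> closure (polycap a c)"
      unfolding closure_sequential by auto
  qed
qed

lemma norm_diff_unit_sq_le:
  fixes a s :: complex
  assumes "norm a = 1" "norm s \<le> 1"
  shows "(norm (s - a))\<^sup>2 \<le> 2 - 2 * (a \<bullet> s)"
proof -
  have "(norm (s - a))\<^sup>2 = (norm s)\<^sup>2 - 2 * (a \<bullet> s) + (norm a)\<^sup>2"
    by (simp add: power2_norm_eq_inner inner_diff_left inner_diff_right inner_commute)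
  moreover have "(norm s)\<^sup>2 \<le> 1"
    using assms by (simp add: power_le_one)
  ultimately show ?thesis
    using assms by simp
qed

text \<open>
  On a unit disc cap \<open>\<bar>s - a\<bar>\<^sup>2 \<le> 2 - 2 (a \<bullet> s) < 2 - 2 c\<close>, so products of caps shrink to the point \<open>z\<close> of the
  torus as \<open>c\<close> tends to \<open>1\<close>.
\<close>

lemma exists_polycap_subset:
  fixes z :: "complex^'n"
  assumes "open U" "z \<in> U" and z: "z \<in> torus"
  obtains c where "0 < c" "c < 1" "polycap z c \<subseteq> U"
proof -
  obtain d where d: "0 < d" "ball z d \<subseteq> U"
    using assms openE by blast
  define e where "e = min 1 (d / (2 * real CARD('n)))"
  have e: "0 < e" "e \<le> 1"
    using d by (auto simp: e_def)
  \<comment> \<open>Solves \<open>2 - 2 c = e\<^sup>2\<close>.\<close>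
  define c where "c = 1 - e\<^sup>2 / 2"
  have e2: "0 < e\<^sup>2" "e\<^sup>2 \<le> 1"
    using e by (auto simp: power_le_one)
  have "polycap z c \<subseteq> U"
  proof
    fix w assume w: "w \<in> polycap z c"
    have le: "norm ((w - z) $ i) \<le> e" for i
    proof -
      have "norm (w $ i) < 1" "c < z $ i \<bullet> w $ i"
        using w by (auto simp: polycap_def cap_def)
      then have "(norm (w $ i - z $ i))\<^sup>2 \<le> e\<^sup>2"
        using norm_diff_unit_sq_le[of "z $ i" "w $ i"] z by (simp add: torus_def c_def)
      then show ?thesis
        using e by (simp add: power2_le_iff_abs_le)
    qed
    have "norm (w - z) \<le> (\<Sum>i\<in>UNIV. norm ((w - z) $ i))"
      unfolding norm_vec_def by (rule L2_set_le_sum) simp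
    also have "\<dots> \<le> real CARD('n) * e"
      using sum_bounded_above[of UNIV "\<lambda>i. norm ((w - z) $ i)" e] le by simp
    also have "\<dots> \<le> real CARD('n) * (d / (2 * real CARD('n)))"
      by (intro mult_left_mono) (auto simp: e_def)
    also have "\<dots> < d"
      using d by simp
    finally show "w \<in> U"
      using d by (auto simp: dist_norm norm_minus_commute)
  qed
  moreover have "0 < c" "c < 1"
    using e2 by (auto simp: c_def)
  ultimately show ?thesis
    using that by blast
qed

section \<open>Slices of separately continuous functions\<close>

lemma set_coord_nth [simp]: "set_coord i s w $ j = (if j = i then s else w $ j)"
  by (simp add: set_coord_def)

lemma set_coord_same [simp]: "set_coord i (w $ i) w = w"
  by (simp add: vec_eq_iff)

lemma set_coord_commute:
  "i \<noteq> j \<Longrightarrow> set_coord i s (set_coord j t w) = set_coord j t (set_coord i s w)"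
  by (simp add: vec_eq_iff)

lemma norm_vector_smult: "norm (c *s v) = norm c * norm v" for v :: "complex^'n"
  by (simp add: norm_vec_def norm_mult L2_set_right_distrib)

lemma has_derivative_affine_complex:
  fixes v :: "complex^'n"
  shows "((\<lambda>t. x + t *s v) has_derivative (\<lambda>h. h *s v)) (at s)"
proof -
  have "linear (\<lambda>h. h *s v)"
    by (intro linearI) (simp_all add: vec_eq_iff algebra_simps)
  then have "bounded_linear (\<lambda>h. h *s v)"
    by (simp add: linear_conv_bounded_linear)
  then have "((\<lambda>t. t *s v) has_derivative (\<lambda>h. h *s v)) (at s)"
    by (rule bounded_linear_imp_has_derivative)
  then show ?thesis
    using has_derivative_add[OF has_derivative_const[of x]] by fastforce
qed

lemma has_field_derivative_along_complex_line:
  fixes F :: "complex^'n \<Rightarrow> complex"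
  assumes F: "(F has_derivative L) (at (x + s *s v))" and L: "\<And>c v. L (c *s v) = c * L v"
  shows "((\<lambda>t. F (x + t *s v)) has_field_derivative L v) (at s)"
proof -
  have "((\<lambda>t. F (x + t *s v)) has_derivative (\<lambda>h. L (h *s v))) (at s)"
    by (rule has_derivative_compose[OF has_derivative_affine_complex F])
  then show ?thesis
    by (simp add: has_field_derivative_def L mult.commute[of _ "L v"])
qed

lemma set_coord_eq_affine: "set_coord i s w = set_coord i 0 w + s *s axis i 1"
  by (simp add: vec_eq_iff axis_def)

lemma holomorphic_several_imp_slice:
  assumes "holomorphic_several F S" "\<And>s. s \<in> T \<Longrightarrow> set_coord i s w \<in> S"
  shows "(\<lambda>s. F (set_coord i s w)) holomorphic_on T"
  unfolding holomorphic_on_def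
proof
  fix s assume "s \<in> T"
  then obtain L where "(F has_derivative L) (at (set_coord i s w))" "\<And>c v. L (c *s v) = c * L v"
    using assms unfolding holomorphic_several_def by blast
  then have "((\<lambda>t. F (set_coord i t w)) has_field_derivative L (axis i 1)) (at s)"
    using has_field_derivative_along_complex_line[of F L "set_coord i 0 w" s "axis i 1"]
    by (simp only: set_coord_eq_affine[symmetric])
  then show "(\<lambda>s. F (set_coord i s w)) field_differentiable at s within T"
    using field_differentiable_at_within field_differentiable_def by blast
qed

text \<open>
  By Montel's theorem a subsequence has a holomorphic limit, which can only be the pointwise limit.
\<close>

lemma bounded_pointwise_limit_holomorphic:
  assumes "open S" and hol: "\<And>n::nat. \<phi> n holomorphic_on S"
    and bound: "\<And>n s. s \<in> S \<Longrightarrow> norm (\<phi> n s) \<le> M"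
    and lim: "\<And>s. s \<in> S \<Longrightarrow> (\<lambda>n. \<phi> n s) \<longlonglongrightarrow> \<psi> s"
  shows "\<psi> holomorphic_on S"
proof -
  obtain g r where g: "g holomorphic_on S" and r: "strict_mono (r :: nat \<Rightarrow> nat)"
    and gr: "\<And>x. x \<in> S \<Longrightarrow> ((\<lambda>n. \<phi> (r n) x) \<longlongrightarrow> g x) sequentially"
  proof (rule Montel[OF \<open>open S\<close>, of "range \<phi>" \<phi>])
    show "\<exists>B. \<forall>h\<in>range \<phi>. \<forall>z\<in>K. norm (h z) \<le> B" if "compact K" "K \<subseteq> S" for K
      using bound that(2) by (intro exI[of _ M]) auto
  qed (use hol in auto)
  have "g s = \<psi> s" if "s \<in> S" for s
    using LIMSEQ_unique[OF gr[OF that] LIMSEQ_subseq_LIMSEQ[OF lim[OF that] r, unfolded o_def]] .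
  then show ?thesis
    using g holomorphic_cong by blast
qed

text \<open>
  Separate continuity without the boundedness, since the quantitative arguments carry an explicit bound.
\<close>

definition separately_continuous_on :: "(complex^'n) set \<Rightarrow> (complex^'n \<Rightarrow> complex) \<Rightarrow> bool" where
  "separately_continuous_on S F \<longleftrightarrow>
     (\<forall>w\<in>S. \<forall>i. continuous_on {c. set_coord i c w \<in> S} (\<lambda>c. F (set_coord i c w)))"

lemma separately_continuous_onD:
  "separately_continuous_on S F \<Longrightarrow> w \<in> S \<Longrightarrow> T \<subseteq> {c. set_coord i c w \<in> S} \<Longrightarrow>
    continuous_on T (\<lambda>c. F (set_coord i c w))"
  unfolding separately_continuous_on_def using continuous_on_subset by blast

lemma separately_continuous_on_subset:
  assumes "separately_continuous_on S F" "T \<subseteq> S"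
  shows "separately_continuous_on T F"
  unfolding separately_continuous_on_def
proof (intro ballI allI)
  show "continuous_on {c. set_coord i c w \<in> T} (\<lambda>c. F (set_coord i c w))" if "w \<in> T" for w i
    using that assms by (intro separately_continuous_onD[OF assms(1)]) auto
qed

lemma separately_continuous_on_uniform_limit:
  assumes "\<And>n::nat. separately_continuous_on S (F n)" "uniform_limit S F G sequentially"
  shows "separately_continuous_on S G"
  unfolding separately_continuous_on_def
proof (intro ballI allI)
  fix w i assume w: "w \<in> S"
  let ?T = "{c. set_coord i c w \<in> S}"
  have "uniform_limit ?T (\<lambda>n c. F n (set_coord i c w)) (\<lambda>c. G (set_coord i c w)) sequentially"
    using assms(2) unfolding uniform_limit_iff by (auto elim!: eventually_mono)
  then show "continuous_on ?T (\<lambda>c. G (set_coord i c w))"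
    using assms(1) w unfolding separately_continuous_on_def
    by (intro uniform_limit_theorem[where f = "\<lambda>n c. F n (set_coord i c w)"]) auto
qed

lemma norm_le_uniform_limit:
  assumes "\<And>n::nat. \<forall>w\<in>S. norm (F n w) \<le> M" "uniform_limit S F G sequentially"
  shows "\<forall>w\<in>S. norm (G w) \<le> M"
  using assms by (intro ballI Lim_norm_ubound[OF _ tendsto_uniform_limitI[OF assms(2)]]) auto

lemma continuous_set_coord: "continuous_on T (\<lambda>c. set_coord i c w)"
proof -
  have eq: "(\<lambda>c. set_coord i c w) = (\<lambda>c. set_coord i 0 w + c *s axis i 1)"
    by (rule ext) (rule set_coord_eq_affine)
  show ?thesis
    unfolding eq
    by (intro continuous_at_imp_continuous_on ballI has_derivative_continuous[OF has_derivative_affine_complex])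
qed

lemma continuous_on_imp_separately_continuous_on:
  "continuous_on S F \<Longrightarrow> separately_continuous_on S F"
  unfolding separately_continuous_on_def
  by (auto intro!: continuous_on_compose2[OF _ continuous_set_coord])

lemma bounded_separately_continuous_iff:
  "bounded_separately_continuous S F \<longleftrightarrow> bounded (F ` S) \<and> separately_continuous_on S F"
  by (simp add: bounded_separately_continuous_def separately_continuous_on_def)

lemma bounded_separately_continuous_subset:
  "bounded_separately_continuous S F \<Longrightarrow> T \<subseteq> S \<Longrightarrow> bounded_separately_continuous T F"
  unfolding bounded_separately_continuous_iff
  using separately_continuous_on_subset bounded_subset[OF _ image_mono] by blast

lemma continuous_on_compact_imp_bounded_separately_continuous:
  "compact S \<Longrightarrow> continuous_on S F \<Longrightarrow> bounded_separately_continuous S F"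
  by (simp add: bounded_separately_continuous_iff compact_continuous_image compact_imp_bounded
      continuous_on_imp_separately_continuous_on)

lemma set_coord_in_closed_polycap:
  "w \<in> closed_polycap a c \<Longrightarrow> s \<in> closed_cap (a $ i) c \<Longrightarrow> set_coord i s w \<in> closed_polycap a c"
  by (auto simp: closed_polycap_def)

lemma slice_continuous:
  assumes "separately_continuous_on (closed_polycap a c) F" "w \<in> closed_polycap a c"
  shows "continuous_on (closed_cap (a $ j) c) (\<lambda>s. F (set_coord j s w))"
  using assms by (auto intro: separately_continuous_onD set_coord_in_closed_polycap)

text \<open>
  Holomorphy of \<open>F\<close> is only given on the open product, but slices through boundary points are
  holomorphic too. By induction on the set \<open>I\<close> of the coordinates that may lie on the boundary of their
  cap: if \<open>w\<^sub>i\<close> is approximated by points of the open cap, the slices converge pointwise by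
  continuity in the \<open>i\<close>-th variable, and they are bounded, so the limit slice is holomorphic.
\<close>

lemma slice_holomorphic:
  fixes F :: "complex^'n \<Rightarrow> complex"
  assumes a: "a \<in> torus" and c: "0 < c" "c < 1"
    and sep: "separately_continuous_on (closed_polycap a c) F"
    and bound: "\<And>w. w \<in> closed_polycap a c \<Longrightarrow> norm (F w) \<le> M"
    and hol: "holomorphic_several F (polycap a c)"
    and w: "w \<in> closed_polycap a c"
  shows "(\<lambda>s. F (set_coord j s w)) holomorphic_on cap (a $ j) c"
proof -
  have "\<forall>w\<in>closed_polycap a c. (\<forall>i. i \<notin> I \<longrightarrow> i \<noteq> j \<longrightarrow> w $ i \<in> cap (a $ i) c) \<longrightarrow>
      (\<lambda>s. F (set_coord j s w)) holomorphic_on cap (a $ j) c" if "finite I" for I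
    using that
  proof (induction I)
    case empty
    show ?case
      by (auto intro!: holomorphic_several_imp_slice[OF hol] simp: polycap_def)
  next
    case (insert i I)
    show ?case
    proof (cases "i = j")
      case True
      then show ?thesis
        using insert.IH by auto
    next
      case False
      show ?thesis
      proof (intro ballI impI)
        fix w assume w: "w \<in> closed_polycap a c"
          and int: "\<forall>k. k \<notin> insert i I \<longrightarrow> k \<noteq> j \<longrightarrow> w $ k \<in> cap (a $ k) c"
        define u where "u n = (1 - 1 / real (Suc n)) *\<^sub>R (w $ i) +
          (1 / real (Suc n)) *\<^sub>R (((1 + c) / 2) *\<^sub>R (a $ i))" for n
        have u: "u n \<in> cap (a $ i) c" for n
          unfolding u_def using a w c
          by (intro cap_interpolate) (auto simp: torus_def closed_polycap_def)
        then have uc: "u n \<in> closed_cap (a $ i) c" for n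
          using cap_subset_closed_cap by blast
        have ulim: "u \<longlonglongrightarrow> w $ i"
        proof -
          have "u \<longlonglongrightarrow> (1 - 0) *\<^sub>R (w $ i) + 0 *\<^sub>R (((1 + c) / 2) *\<^sub>R (a $ i))"
            unfolding u_def by (intro tendsto_intros LIMSEQ_Suc[OF lim_1_over_n])
          then show ?thesis by simp
        qed
        show "(\<lambda>s. F (set_coord j s w)) holomorphic_on cap (a $ j) c"
        proof (rule bounded_pointwise_limit_holomorphic[OF open_cap,
              where \<phi> = "\<lambda>n s. F (set_coord j s (set_coord i (u n) w))" and M = M])
          fix n
          show "(\<lambda>s. F (set_coord j s (set_coord i (u n) w))) holomorphic_on cap (a $ j) c"
            using insert.IH set_coord_in_closed_polycap[OF w uc] int u by auto
        next
          fix n s assume "s \<in> cap (a $ j) c"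
          then have "s \<in> closed_cap (a $ j) c"
            using cap_subset_closed_cap by blast
          then show "norm (F (set_coord j s (set_coord i (u n) w))) \<le> M"
            by (intro bound set_coord_in_closed_polycap w uc)
        next
          fix s assume "s \<in> cap (a $ j) c"
          then have w': "set_coord j s w \<in> closed_polycap a c"
            using cap_subset_closed_cap set_coord_in_closed_polycap[OF w] by blast
          have wi: "w $ i \<in> closed_cap (a $ i) c"
            using w by (simp add: closed_polycap_def)
          have "(\<lambda>n. F (set_coord i (u n) (set_coord j s w))) \<longlonglongrightarrow>
              F (set_coord i (w $ i) (set_coord j s w))"
            using continuous_on_tendsto_compose[OF slice_continuous[OF sep w', of i] ulim wi] uc
            by auto
          moreover have "set_coord i (w $ i) (set_coord j s w) = set_coord j s w"
            using False by (simp add: vec_eq_iff)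
          ultimately show "(\<lambda>n. F (set_coord j s (set_coord i (u n) w))) \<longlonglongrightarrow> F (set_coord j s w)"
            by (simp add: set_coord_commute[OF False])
        qed
      qed
    qed
  qed
  from this[of UNIV] w show ?thesis
    by auto
qed

section \<open>Stability of extensions\<close>

text \<open>
  By induction on the set \<open>J\<close> of the coordinates that have left the circle. When \<open>j\<close> joins \<open>J\<close>, the slice
  in the \<open>j\<close>-th variable is small on the arc by the induction hypothesis and bounded by \<open>M\<close> on the cap, so
  the two-constants estimate makes it small on the smaller cap. The order of the quantifiers matters:
  \<open>\<epsilon>\<close> depends on \<open>\<eta>\<close> and \<open>M\<close> but not on \<open>F\<close>.
\<close>

lemma small_on_torus_imp_small:
  fixes a :: "complex^'n" and M :: real
  assumes a: "a \<in> torus" and c: "0 < c" "c < c'" "c' < 1" and \<eta>: "0 < \<eta>"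
  obtains \<epsilon> where "0 < \<epsilon>"
    "\<And>F w. \<lbrakk>separately_continuous_on (closed_polycap a c) F;
      \<And>w. w \<in> closed_polycap a c \<Longrightarrow> norm (F w) \<le> M;
      holomorphic_several F (polycap a c);
      \<And>w. w \<in> torus \<inter> closed_polycap a c \<Longrightarrow> norm (F w) \<le> \<epsilon>;
      w \<in> closed_polycap a c'\<rbrakk> \<Longrightarrow> norm (F w) \<le> \<eta>"
proof -
  define good where "good F \<longleftrightarrow> separately_continuous_on (closed_polycap a c) F \<and>
      (\<forall>w. w \<in> closed_polycap a c \<longrightarrow> norm (F w) \<le> M) \<and> holomorphic_several F (polycap a c)" for F
  have "\<exists>\<epsilon>>0. \<forall>F. good F \<longrightarrow> (\<forall>w\<in>torus \<inter> closed_polycap a c. norm (F w) \<le> \<epsilon>) \<longrightarrow>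
      (\<forall>w\<in>closed_polycap a c. (\<forall>i\<in>J. w $ i \<in> closed_cap (a $ i) c') \<longrightarrow>
         (\<forall>i. i \<notin> J \<longrightarrow> norm (w $ i) = 1) \<longrightarrow> norm (F w) \<le> \<eta>)"
    if "finite J" "0 < \<eta>" for J \<eta>
    using that
  proof (induction J arbitrary: \<eta>)
    case empty
    then show ?case
      by (intro exI[of _ \<eta>]) (auto simp: torus_def)
  next
    case (insert j J)
    have aj: "norm (a $ j) = 1"
      using a by (simp add: torus_def)
    obtain \<epsilon>1 where \<epsilon>1: "0 < \<epsilon>1"
      "\<And>\<phi> s. \<lbrakk>continuous_on (closed_cap (a $ j) c) \<phi>; \<phi> holomorphic_on cap (a $ j) c;
        \<And>s. s \<in> closed_cap (a $ j) c \<Longrightarrow> norm (\<phi> s) \<le> M;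
        \<And>s. s \<in> closed_cap (a $ j) c \<Longrightarrow> norm s = 1 \<Longrightarrow> norm (\<phi> s) \<le> \<epsilon>1;
        s \<in> closed_cap (a $ j) c'\<rbrakk> \<Longrightarrow> norm (\<phi> s) \<le> \<eta>"
      using two_constants_on_cap[OF aj c(2) insert.prems, of M] by blast
    obtain \<epsilon> where \<epsilon>: "0 < \<epsilon>"
      "\<And>F w. good F \<Longrightarrow> (\<forall>w\<in>torus \<inter> closed_polycap a c. norm (F w) \<le> \<epsilon>) \<Longrightarrow>
        w \<in> closed_polycap a c \<Longrightarrow> \<forall>i\<in>J. w $ i \<in> closed_cap (a $ i) c' \<Longrightarrow>
        \<forall>i. i \<notin> J \<longrightarrow> norm (w $ i) = 1 \<Longrightarrow> norm (F w) \<le> \<epsilon>1"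
      using insert.IH[OF \<epsilon>1(1)] by blast
    show ?case
    proof (intro exI[of _ \<epsilon>] conjI allI impI ballI)
      fix F w
      assume F: "good F" and small: "\<forall>w\<in>torus \<inter> closed_polycap a c. norm (F w) \<le> \<epsilon>"
        and w: "w \<in> closed_polycap a c"
        and wJ: "\<forall>i\<in>insert j J. w $ i \<in> closed_cap (a $ i) c'"
        and w1: "\<forall>i. i \<notin> insert j J \<longrightarrow> norm (w $ i) = 1"
      have "norm (F (set_coord j (w $ j) w)) \<le> \<eta>"
      proof (rule \<epsilon>1(2)[where \<phi> = "\<lambda>s. F (set_coord j s w)"])
        show "continuous_on (closed_cap (a $ j) c) (\<lambda>s. F (set_coord j s w))"
          using F w slice_continuous unfolding good_def by blast
        show "(\<lambda>s. F (set_coord j s w)) holomorphic_on cap (a $ j) c"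
          using F w c slice_holomorphic[OF a, of c F M w j] unfolding good_def by auto
        show "w $ j \<in> closed_cap (a $ j) c'"
          using wJ by simp
      next
        fix s assume "s \<in> closed_cap (a $ j) c"
        then have s: "set_coord j s w \<in> closed_polycap a c"
          using set_coord_in_closed_polycap[OF w] by blast
        then show "norm (F (set_coord j s w)) \<le> M"
          using F unfolding good_def by blast
        assume "norm s = 1"
        then show "norm (F (set_coord j s w)) \<le> \<epsilon>1"
          using \<epsilon>(2)[OF F small s] wJ w1 insert.hyps by auto
      qed
      then show "norm (F w) \<le> \<eta>"
        by simp
    qed (use \<epsilon> in auto)
  qed
  from this[OF finite[of UNIV] \<eta>] obtain \<epsilon> where \<epsilon>: "0 < \<epsilon>"
    "\<And>F w. good F \<Longrightarrow> (\<forall>w\<in>torus \<inter> closed_polycap a c. norm (F w) \<le> \<epsilon>) \<Longrightarrow>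
       w \<in> closed_polycap a c \<Longrightarrow> (\<forall>i. w $ i \<in> closed_cap (a $ i) c') \<Longrightarrow> norm (F w) \<le> \<eta>"
    by auto
  show ?thesis
  proof (rule that[OF \<epsilon>(1)])
    fix F w
    assume "separately_continuous_on (closed_polycap a c) F"
      "\<And>w. w \<in> closed_polycap a c \<Longrightarrow> norm (F w) \<le> M" "holomorphic_several F (polycap a c)"
      "\<And>w. w \<in> torus \<inter> closed_polycap a c \<Longrightarrow> norm (F w) \<le> \<epsilon>"
      and w: "w \<in> closed_polycap a c'"
    moreover have "w \<in> closed_polycap a c"
      using w closed_polycap_mono[of c c' a] c by auto
    moreover have "\<forall>i. w $ i \<in> closed_cap (a $ i) c'"
      using w by (simp add: closed_polycap_def)
    ultimately show "norm (F w) \<le> \<eta>"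
      using \<epsilon>(2)[of F w] unfolding good_def by blast
  qed
qed

text \<open>
  Restricted to complex lines, differences \<open>F\<^sub>m - F\<^sub>n\<close> are holomorphic functions of one variable, so
  Cauchy's inequality bounds the differences of the derivatives by those of the functions. The derivatives
  therefore converge locally uniformly, and the total derivative of the limit is the limit of
  the derivatives. Complex linearity passes to the limit.
\<close>

lemma holomorphic_several_uniform_limit:
  fixes F :: "nat \<Rightarrow> complex^'n \<Rightarrow> complex"
  assumes "open S" and hol: "\<And>n. holomorphic_several (F n) S"
    and ulim: "uniform_limit S F G sequentially"
  shows "holomorphic_several G S"
  unfolding holomorphic_several_def
proof
  fix w assume "w \<in> S"
  then obtain r' where r': "0 < r'" "ball w r' \<subseteq> S"
    using \<open>open S\<close> openE by blast
  define r where "r = r' / 2"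
  have r: "0 < r" "ball w (2 * r) \<subseteq> S"
    using r' by (auto simp: r_def)
  have "\<forall>n. \<forall>x\<in>S. \<exists>L. (F n has_derivative L) (at x) \<and> (\<forall>c v. L (c *s v) = c * L v)"
    using hol unfolding holomorphic_several_def by blast
  then obtain D where D: "\<And>n x. x \<in> S \<Longrightarrow> (F n has_derivative D n x) (at x)"
    and Dlin: "\<And>n x c v. x \<in> S \<Longrightarrow> D n x (c *s v) = c * D n x v"
    by metis
  have ballS: "x \<in> S" if "x \<in> ball w r" for x
    using that r by (auto simp: subset_iff)
  have cauchy: "norm (D m x h - D n x h) \<le> 2 * B / r * norm h"
    if x: "x \<in> ball w r" and B: "\<And>y. y \<in> S \<Longrightarrow> norm (F m y - F n y) \<le> B" for m n x h B
  proof (cases "h = 0")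
    case True
    then show ?thesis
      using Dlin[OF ballS[OF x], of _ 0 0] by simp
  next
    case False
    \<comment> \<open>The disc of radius \<open>\<rho>\<close> in the direction \<open>h\<close> stays within distance \<open>r\<close> of \<open>x\<close>.\<close>
    define \<rho> where "\<rho> = r / (2 * norm h)"
    have \<rho>: "0 < \<rho>"
      using False r by (simp add: \<rho>_def)
    have line: "x + t *s h \<in> S" if "norm t \<le> \<rho>" for t
    proof -
      have "norm (t *s h) \<le> \<rho> * norm h"
        unfolding norm_vector_smult using that by (intro mult_right_mono) auto
      also have "\<dots> < r"
        using False r by (simp add: \<rho>_def)
      finally have "norm (w - (x + t *s h)) < 2 * r"
        using x norm_triangle_ineq4[of "w - x" "t *s h"]
        by (simp add: dist_norm algebra_simps)
      then show ?thesis
        using r(2) by (auto simp: dist_norm subset_iff)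
    qed
    define \<phi> where "\<phi> t = F m (x + t *s h) - F n (x + t *s h)" for t
    have d\<phi>: "(\<phi> has_field_derivative D m (x + t *s h) h - D n (x + t *s h) h) (at t)"
      if "norm t \<le> \<rho>" for t
      unfolding \<phi>_def using line[OF that] D Dlin
      by (intro derivative_intros has_field_derivative_along_complex_line) auto
    have "norm ((deriv ^^ 1) \<phi> 0) \<le> fact 1 * B / \<rho> ^ 1"
    proof (rule Cauchy_inequality[OF _ _ \<rho>])
      show "\<phi> holomorphic_on ball 0 \<rho>"
        unfolding holomorphic_on_def using d\<phi>
        by (auto simp: dist_norm field_differentiable_def intro!: exI DERIV_subset[OF d\<phi>])
      show "continuous_on (cball 0 \<rho>) \<phi>"
        using d\<phi> by (intro continuous_at_imp_continuous_on ballI DERIV_isCont[OF d\<phi>]) auto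
      show "norm (\<phi> t) \<le> B" if "norm (0 - t) = \<rho>" for t
        unfolding \<phi>_def using that by (intro B line) auto
    qed
    moreover have "deriv \<phi> 0 = D m x h - D n x h"
      using DERIV_imp_deriv[OF d\<phi>[of 0]] \<rho> by simp
    ultimately have "norm (D m x h - D n x h) \<le> B / \<rho>"
      by simp
    then show ?thesis
      by (simp add: \<rho>_def field_simps)
  qed
  have ucauchy: "\<exists>N. \<forall>m\<ge>N. \<forall>n\<ge>N. \<forall>x\<in>ball w r. \<forall>h. norm (D m x h - D n x h) \<le> e * norm h"
    if e: "0 < e" for e
  proof -
    have "uniformly_Cauchy_on S F"
      using ulim uniformly_convergent_Cauchy uniformly_convergent_on_def by blast
    then obtain N where N: "\<And>m n y. m \<ge> N \<Longrightarrow> n \<ge> N \<Longrightarrow> y \<in> S \<Longrightarrow> norm (F m y - F n y) \<le> e * r / 2"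
      using e r unfolding uniformly_Cauchy_on_def dist_norm
      by (metis half_gt_zero less_imp_le mult_pos_pos)
    have "norm (D m x h - D n x h) \<le> e * norm h" if "m \<ge> N" "n \<ge> N" "x \<in> ball w r" for m n x h
      using cauchy[OF that(3) N[OF that(1,2)], of h] r by simp
    then show ?thesis
      by blast
  qed
  define L where "L x h = lim (\<lambda>n. D n x h)" for x h
  have L: "(\<lambda>n. D n x h) \<longlonglongrightarrow> L x h" if x: "x \<in> ball w r" for x h
  proof -
    have "Cauchy (\<lambda>n. D n x h)"
    proof (rule metric_CauchyI)
      fix e :: real assume e: "0 < e"
      define e' where "e' = e / (norm h + 1)"
      have hp: "0 < norm h + 1"
        using norm_ge_zero[of h] by linarith
      have "e' * norm h < e"
        using e hp by (simp add: e'_def field_simps)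
      moreover have "0 < e'"
        using e hp by (simp add: e'_def)
      then obtain N where "\<And>m n. m \<ge> N \<Longrightarrow> n \<ge> N \<Longrightarrow> norm (D m x h - D n x h) \<le> e' * norm h"
        using ucauchy x by blast
      ultimately show "\<exists>N. \<forall>m\<ge>N. \<forall>n\<ge>N. dist (D m x h) (D n x h) < e"
        unfolding dist_norm by (meson le_less_trans)
    qed
    then show ?thesis
      unfolding L_def by (simp add: Cauchy_convergent_iff convergent_LIMSEQ_iff)
  qed
  have "\<exists>g. \<forall>x\<in>ball w r. (\<lambda>n. F n x) \<longlonglongrightarrow> g x \<and> (g has_derivative L x) (at x within ball w r)"
  proof (rule has_derivative_sequence[OF convex_ball])
    show "(F n has_derivative D n x) (at x within ball w r)" if "x \<in> ball w r" for n x
      using D[OF ballS[OF that]] has_derivative_at_withinI by blast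
    show "w \<in> ball w r"
      using r by simp
    show "(\<lambda>n. F n w) \<longlonglongrightarrow> G w"
      using tendsto_uniform_limitI[OF ulim \<open>w \<in> S\<close>] .
    fix e :: real assume "0 < e"
    then obtain N where N: "\<And>m n x h. m \<ge> N \<Longrightarrow> n \<ge> N \<Longrightarrow> x \<in> ball w r \<Longrightarrow>
        norm (D m x h - D n x h) \<le> e * norm h"
      using ucauchy by blast
    have "norm (D n x h - L x h) \<le> e * norm h" if "n \<ge> N" "x \<in> ball w r" for n x h
    proof (rule tendsto_upperbound)
      show "(\<lambda>m. norm (D n x h - D m x h)) \<longlonglongrightarrow> norm (D n x h - L x h)"
        by (intro tendsto_intros L that)
      show "\<forall>\<^sub>F m in sequentially. norm (D n x h - D m x h) \<le> e * norm h"
        using N[OF that(1) _ that(2)] eventually_sequentially by blast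
    qed simp
    then show "\<forall>\<^sub>F n in sequentially. \<forall>x\<in>ball w r. \<forall>h. norm (D n x h - L x h) \<le> e * norm h"
      using eventually_sequentially by blast
  qed
  then obtain g where g: "\<And>x. x \<in> ball w r \<Longrightarrow> (\<lambda>n. F n x) \<longlonglongrightarrow> g x"
    and dg: "\<And>x. x \<in> ball w r \<Longrightarrow> (g has_derivative L x) (at x within ball w r)"
    by blast
  have wr: "w \<in> ball w r"
    using r by simp
  have "g x = G x" if "x \<in> ball w r" for x
    using LIMSEQ_unique[OF g[OF that] tendsto_uniform_limitI[OF ulim ballS[OF that]]] .
  moreover have "(g has_derivative L w) (at w)"
    using dg[OF wr] at_within_open[OF wr open_ball] by simp
  ultimately have "(G has_derivative L w) (at w)"
    using has_derivative_transform_within_open[OF _ open_ball wr] by blast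
  moreover have "L w (c *s v) = c * L w v" for c v
  proof (rule LIMSEQ_unique)
    show "(\<lambda>n. D n w (c *s v)) \<longlonglongrightarrow> L w (c *s v)"
      by (rule L[OF wr])
    show "(\<lambda>n. D n w (c *s v)) \<longlonglongrightarrow> c * L w v"
      unfolding Dlin[OF \<open>w \<in> S\<close>] by (intro tendsto_intros L[OF wr])
  qed
  ultimately show "\<exists>L. (G has_derivative L) (at w) \<and> (\<forall>c v. L (c *s v) = c * L v)"
    by blast
qed

section \<open>Extendability over a fixed open set\<close>

text \<open>
  Extendability at a point asks for some neighbourhood. Fixing it makes countability arguments possible.
\<close>

definition extends_over ::
  "((complex^'n) set \<Rightarrow> (complex^'n \<Rightarrow> complex) \<Rightarrow> bool) \<Rightarrow>
   (complex^'n) set \<Rightarrow> (complex^'n \<Rightarrow> complex) \<Rightarrow> bool" where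
  "extends_over R U f \<longleftrightarrow>
     (\<exists>F. R (closure (U \<inter> polydisc)) F \<and> holomorphic_several F (U \<inter> polydisc) \<and>
        (\<forall>w \<in> torus \<inter> closure (U \<inter> polydisc). F w = f w))"

lemma one_side_extendable_iff_extends_over:
  "one_side_extendable R f z \<longleftrightarrow> (\<exists>U. open U \<and> z \<in> U \<and> extends_over R U f)"
  by (auto simp: one_side_extendable_def extends_over_def)

lemma extends_over_mono:
  assumes "extends_over R U f" "V \<inter> polydisc \<subseteq> U"
    and R: "\<And>S T F. R S F \<Longrightarrow> T \<subseteq> S \<Longrightarrow> R T F"
  shows "extends_over R V f"
proof -
  have sub: "closure (V \<inter> polydisc) \<subseteq> closure (U \<inter> polydisc)"
    using assms(2) by (intro closure_mono) auto
  then show ?thesis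
    using assms(1,2) R[OF _ sub] unfolding extends_over_def holomorphic_several_def by blast
qed

lemma extends_over_weaken:
  assumes "extends_over R U f" "\<And>F. R (closure (U \<inter> polydisc)) F \<Longrightarrow> R' (closure (U \<inter> polydisc)) F"
  shows "extends_over R' U f"
  using assms unfolding extends_over_def by blast

lemma bounded_polydisc: "bounded (polydisc :: (complex^'n) set)"
proof (rule boundedI)
  fix w :: "complex^'n" assume "w \<in> polydisc"
  then have "norm (w $ i) \<le> 1" for i
    by (simp add: polydisc_def less_imp_le)
  then show "norm w \<le> real CARD('n)"
    using sum_bounded_above[of UNIV "\<lambda>i. norm (w $ i)" 1] L2_set_le_sum[of UNIV "\<lambda>i. norm (w $ i)"]
    by (simp add: norm_vec_def)
qed

lemma compact_closure_Int_polydisc: "compact (closure (U \<inter> polydisc :: (complex^'n) set))"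
  using bounded_polydisc bounded_Int compact_closure by blast

section \<open>The topology of the spaces of differentiable functions\<close>

lemma compact_torus: "compact (torus :: (complex^'n) set)"
proof -
  have eq: "torus = (\<Inter>i. {w :: complex^'n. norm (w $ i) = 1})"
    by (auto simp: torus_def)
  have "closed (torus :: (complex^'n) set)"
    unfolding eq by (intro closed_INT ballI closed_Collect_eq continuous_intros)
  moreover have "bounded (torus :: (complex^'n) set)"
  proof (rule boundedI)
    fix w :: "complex^'n" assume "w \<in> torus"
    then show "norm w \<le> real CARD('n)"
      using L2_set_le_sum[of UNIV "\<lambda>i. norm (w $ i)"] by (simp add: norm_vec_def torus_def)
  qed
  ultimately show ?thesis
    by (simp add: compact_eq_bounded_closed)
qed

lemma torus_nonempty: "(torus :: (complex^'n) set) \<noteq> {}"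
proof -
  have "(\<chi> i. 1) \<in> (torus :: (complex^'n) set)"
    by (simp add: torus_def)
  then show ?thesis by blast
qed

lemma bdd_above_norm_torus:
  fixes g :: "complex^'n \<Rightarrow> complex"
  assumes "continuous_on torus g"
  shows "bdd_above ((\<lambda>z. norm (g z)) ` torus)"
  using compact_continuous_image[OF continuous_on_norm[OF assms] compact_torus]
  by (intro bounded_imp_bdd_above compact_imp_bounded)

lemma norm_le_Cp_seminorm:
  assumes "continuous_on torus (iter_partial js g)" "z \<in> torus"
  shows "norm (iter_partial js g z) \<le> Cp_seminorm js g"
  unfolding Cp_seminorm_def by (rule cSUP_upper[OF assms(2) bdd_above_norm_torus[OF assms(1)]])

lemma Cp_seminorm_le:
  fixes g :: "complex^'n \<Rightarrow> complex"
  assumes "\<And>z. z \<in> torus \<Longrightarrow> norm (iter_partial js g z) \<le> B"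
  shows "Cp_seminorm js g \<le> B"
  unfolding Cp_seminorm_def by (rule cSUP_least[OF torus_nonempty assms])

lemma rotate_coord_in_torus: "z \<in> torus \<Longrightarrow> rotate_coord j t z \<in> torus"
  by (simp add: torus_def rotate_coord_def set_coord_def norm_mult)

lemma rotate_coord_0 [simp]: "rotate_coord j 0 z = z"
  by (simp add: rotate_coord_def)

lemma iter_partial_Nil [simp]: "iter_partial [] f = f"
  by (simp add: iter_partial_def)

lemma iter_partial_Cons:
  "iter_partial (j # js) f z = vector_derivative (\<lambda>t. iter_partial js f (rotate_coord j t z)) (at 0)"
  by (simp add: iter_partial_def partial_theta_def)

text \<open>
  As \<open>vector_derivative\<close> is total, linearity needs the existence of the derivatives, which is inherited
  by the combination. Only the values of \<open>k\<close> on the torus are prescribed, so \<open>k\<close> may be the restriction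
  that belongs to \<open>Cp\<close> or the pointwise difference that occurs in the definition of the topology.
\<close>

lemma iter_partial_lincomb:
  assumes "iter_partial_exists js f" "iter_partial_exists js h"
    and k: "\<And>z. z \<in> torus \<Longrightarrow> k z = f z + c * h z"
  shows "iter_partial_exists js k \<and>
    (\<forall>z\<in>torus. iter_partial js k z = iter_partial js f z + c * iter_partial js h z)"
  using assms(1,2)
proof (induction js)
  case Nil
  then show ?case
    using k by simp
next
  case (Cons j js)
  let ?D = "\<lambda>f t z. iter_partial js f (rotate_coord j t z)"
  have IH: "iter_partial_exists js k"
    "\<And>z. z \<in> torus \<Longrightarrow> iter_partial js k z = iter_partial js f z + c * iter_partial js h z"
    using Cons by auto
  have "((\<lambda>t. ?D k t z) has_vector_derivative
      iter_partial (j # js) f z + c * iter_partial (j # js) h z) (at 0)" if z: "z \<in> torus" for z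
  proof -
    have "((\<lambda>t. ?D f t z) has_vector_derivative iter_partial (j # js) f z) (at 0)"
      "((\<lambda>t. ?D h t z) has_vector_derivative iter_partial (j # js) h z) (at 0)"
      using Cons.prems z unfolding iter_partial_Cons
      by (auto simp: vector_derivative_works[symmetric])
    then have "((\<lambda>t. ?D f t z + c * ?D h t z) has_vector_derivative
        iter_partial (j # js) f z + c * iter_partial (j # js) h z) (at 0)"
      by (intro has_vector_derivative_add has_vector_derivative_mult_right)
    then show ?thesis
      using IH(2)[OF rotate_coord_in_torus[OF z]] by simp
  qed
  then show ?case
    using IH(1) differentiableI_vector vector_derivative_at
    by (fastforce simp: iter_partial_Cons)
qed

lemma Cp_lincomb:
  assumes f: "f \<in> Cp p" and h: "h \<in> Cp p"
  shows "restrict (\<lambda>z. f z + c * h z) torus \<in> Cp p"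
proof -
  have "iter_partial_exists js (restrict (\<lambda>z. f z + c * h z) torus) \<and>
      continuous_on torus (iter_partial js (restrict (\<lambda>z. f z + c * h z) torus))"
    if js: "enat (length js) \<le> p" for js
  proof -
    have ex: "iter_partial_exists js f" "iter_partial_exists js h"
      and ct: "continuous_on torus (iter_partial js f)" "continuous_on torus (iter_partial js h)"
      using f h js by (auto simp: Cp_def)
    have *: "iter_partial_exists js (restrict (\<lambda>z. f z + c * h z) torus) \<and>
      (\<forall>z\<in>torus. iter_partial js (restrict (\<lambda>z. f z + c * h z) torus) z =
        iter_partial js f z + c * iter_partial js h z)"
      by (rule iter_partial_lincomb[OF ex]) simp
    have "continuous_on torus (\<lambda>z. iter_partial js f z + c * iter_partial js h z)"
      by (intro continuous_intros ct)
    then have "continuous_on torus (iter_partial js (restrict (\<lambda>z. f z + c * h z) torus))"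
      using * continuous_on_eq by (metis (no_types, lifting))
    then show ?thesis
      using * by blast
  qed
  then show ?thesis
    by (simp add: Cp_def)
qed

text \<open>
  Each of the generating sets is given by a seminorm, and \<open>t \<mapsto> |f + t h - g|\<close> is Lipschitz
  with constant \<open>|h|\<close> for each seminorm.
\<close>

lemma continuous_map_line_Cp:
  fixes f h :: "complex^'n \<Rightarrow> complex"
  assumes f: "f \<in> Cp p" and h: "h \<in> Cp p"
  shows "continuous_map euclideanreal (Cp_topology p)
    (\<lambda>t. restrict (\<lambda>z. f z + of_real t * h z) torus)"
    (is "continuous_map _ _ ?line")
  unfolding Cp_topology_def continuous_on_generated_topo_iff
proof (intro conjI allI impI)
  let ?S = "{{f \<in> Cp p. Cp_seminorm js (\<lambda>z. f z - g z) < e} |g js e.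
    g \<in> Cp p \<and> enat (length js) \<le> p \<and> 0 < e} :: (complex^'n \<Rightarrow> complex) set set"
  have "\<Union> ?S = Cp p"
    using topspace_Cp_topology[of p] by (simp only: Cp_topology_def topology_generated_by_topspace)
  then show "?line ` topspace euclideanreal \<subseteq> \<Union> ?S"
    using Cp_lincomb[OF f h] by (simp only: image_subset_iff) simp
next
  fix U :: "(complex^'n \<Rightarrow> complex) set"
  assume "U \<in> {{f \<in> Cp p. Cp_seminorm js (\<lambda>z. f z - g z) < e} |g js e.
        g \<in> Cp p \<and> enat (length js) \<le> p \<and> 0 < e}"
  then obtain g js e where U: "U = {f \<in> Cp p. Cp_seminorm js (\<lambda>z. f z - g z) < e}"
    and g: "g \<in> Cp p" and js: "enat (length js) \<le> p"
    by blast
  define A where "A z = iter_partial js f z - iter_partial js g z" for z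
  have D: "iter_partial_exists js k" "continuous_on torus (iter_partial js k)" if "k \<in> Cp p" for k
    using that js by (auto simp: Cp_def)
  have diff: "iter_partial js (\<lambda>z. ?line t z - g z) z = A z + of_real t * iter_partial js h z"
    if z: "z \<in> torus" for t z
  proof -
    have 1: "iter_partial_exists js (?line t) \<and> (\<forall>z\<in>torus. iter_partial js (?line t) z =
        iter_partial js f z + of_real t * iter_partial js h z)"
      by (rule iter_partial_lincomb[OF D(1)[OF f] D(1)[OF h]]) simp
    have "iter_partial_exists js (\<lambda>z. ?line t z - g z) \<and>
      (\<forall>z\<in>torus. iter_partial js (\<lambda>z. ?line t z - g z) z =
         iter_partial js (?line t) z + (- 1) * iter_partial js g z)"
      by (rule iter_partial_lincomb[OF conjunct1[OF 1] D(1)[OF g]]) simp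
    then show ?thesis
      using 1 z by (simp add: A_def)
  qed
  have cont: "continuous_on torus (iter_partial js (\<lambda>z. ?line t z - g z))" for t
  proof -
    have "continuous_on torus (\<lambda>z. A z + of_real t * iter_partial js h z)"
      unfolding A_def by (intro continuous_intros D f g h)
    then show ?thesis
      by (rule continuous_on_eq) (rule diff[symmetric])
  qed
  define b where "b = Cp_seminorm js h"
  have b: "norm (iter_partial js h z) \<le> b" if "z \<in> torus" for z
    unfolding b_def by (rule norm_le_Cp_seminorm[OF D(2)[OF h] that])
  have b0: "0 \<le> b"
    using b torus_nonempty norm_ge_zero order_trans by blast
  let ?s = "\<lambda>t. Cp_seminorm js (\<lambda>z. ?line t z - g z)"
  have step: "?s t \<le> ?s t0 + \<bar>t - t0\<bar> * b" for t t0
  proof (rule Cp_seminorm_le)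
    fix z :: "complex^'n" assume z: "z \<in> torus"
    have "iter_partial js (\<lambda>z. ?line t z - g z) z =
        iter_partial js (\<lambda>z. ?line t0 z - g z) z + of_real (t - t0) * iter_partial js h z"
      unfolding diff[OF z] by (simp add: algebra_simps)
    also have "norm \<dots> \<le> norm (iter_partial js (\<lambda>z. ?line t0 z - g z) z) +
        \<bar>t - t0\<bar> * norm (iter_partial js h z)"
      by (rule order_trans[OF norm_triangle_ineq]) (simp add: norm_mult del: of_real_diff)
    also have "\<dots> \<le> ?s t0 + \<bar>t - t0\<bar> * b"
      by (intro add_mono mult_left_mono norm_le_Cp_seminorm cont z b) auto
    finally show "norm (iter_partial js (\<lambda>z. ?line t z - g z) z) \<le> ?s t0 + \<bar>t - t0\<bar> * b" .
  qed
  have "open {t. ?s t < e}"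
    unfolding open_dist
  proof
    fix t0 assume "t0 \<in> {t. ?s t < e}"
    then have t0: "?s t0 < e" by simp
    have "?s t < e" if "dist t t0 < (e - ?s t0) / (b + 1)" for t
    proof -
      have "\<bar>t - t0\<bar> * b \<le> \<bar>t - t0\<bar> * (b + 1)"
        by (intro mult_left_mono) auto
      also have "\<dots> < e - ?s t0"
        using that b0 by (simp add: dist_real_def pos_less_divide_eq)
      finally show ?thesis
        using step[of t t0] by linarith
    qed
    then show "\<exists>d>0. \<forall>t. dist t t0 < d \<longrightarrow> t \<in> {t. ?s t < e}"
      using t0 b0 by (intro exI[of _ "(e - ?s t0) / (b + 1)"]) auto
  qed
  moreover have "?line -` U \<inter> topspace euclideanreal = {t. ?s t < e}"
    using Cp_lincomb[OF f h] by (auto simp: U)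
  ultimately show "openin euclideanreal (?line -` U \<inter> topspace euclideanreal)"
    by (simp only: open_openin)
qed

lemma closure_of_Cp_approx:
  assumes f: "f \<in> Cp_topology p closure_of E" and E: "E \<subseteq> Cp p" and "0 < e"
  obtains g where "g \<in> E" "\<And>w. w \<in> torus \<Longrightarrow> norm (g w - f w) < e"
proof -
  have fp: "f \<in> Cp p"
    using f by (simp add: in_closure_of)
  let ?T = "{g \<in> Cp p. Cp_seminorm [] (\<lambda>z. g z - f z) < e}"
  have op: "openin (Cp_topology p) ?T"
    unfolding Cp_topology_def
    using fp \<open>0 < e\<close> by (intro topology_generated_by_Basis) (force simp: zero_enat_def[symmetric])
  have fT: "f \<in> ?T"
    using fp \<open>0 < e\<close> by (simp add: Cp_seminorm_def cSUP_const[OF torus_nonempty])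
  obtain g where g: "g \<in> E" "Cp_seminorm [] (\<lambda>z. g z - f z) < e"
    using conjunct2[OF f[unfolded in_closure_of], THEN spec, THEN mp, OF conjI[OF fT op]] by auto
  have "continuous_on torus k" if "k \<in> Cp p" for k
    using that unfolding Cp_def by (auto dest!: spec[of _ "[]"] simp: zero_enat_def[symmetric])
  then have "continuous_on torus (iter_partial [] (\<lambda>z. g z - f z))"
    using fp g(1) E by (auto intro!: continuous_intros)
  from norm_le_Cp_seminorm[OF this] g that show ?thesis
    by fastforce
qed

section \<open>Borel class of the set of nowhere extendable functions\<close>

text \<open>
  The conditions on \<open>Q\<close> cover both bounded separately continuous functions with bound \<open>M\<close> and Lipschitz
  functions with bound and Lipschitz constant \<open>M\<close>. Extensions of approximants of \<open>f\<close> are uniformly Cauchy on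
  a smaller product of caps by \<open>small_on_torus_imp_small\<close>, applied to their differences, whose bound
  is \<open>2 * M\<close>. The limit extends \<open>f\<close>.
\<close>

lemma one_side_extendable_if_in_closure:
  fixes Q :: "(complex^'n) set \<Rightarrow> (complex^'n \<Rightarrow> complex) \<Rightarrow> bool"
  assumes bound: "\<And>S F w. Q S F \<Longrightarrow> w \<in> S \<Longrightarrow> norm (F w) \<le> M"
    and sep: "\<And>S F. Q S F \<Longrightarrow> separately_continuous_on S F"
    and mono: "\<And>S T F. Q S F \<Longrightarrow> T \<subseteq> S \<Longrightarrow> Q T F"
    and lim: "\<And>S F G. (\<And>n. Q S (F n)) \<Longrightarrow> uniform_limit S F G sequentially \<Longrightarrow> Q S G"
    and U: "open U" "z \<in> U" and z: "z \<in> torus"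
    and f: "f \<in> Cp_topology p closure_of {g \<in> Cp p. extends_over Q U g}"
  shows "one_side_extendable Q f z"
proof -
  obtain c where c: "0 < c" "c < 1" and cU: "polycap z c \<subseteq> U"
    using exists_polycap_subset[OF U z] by blast
  define c' where "c' = (1 + c) / 2"
  have c': "c < c'" "c' < 1" "0 < c'"
    using c by (auto simp: c'_def)
  have "\<exists>g F. (\<forall>w\<in>torus. norm (g w - f w) < 1 / real (Suc n)) \<and> Q (closed_polycap z c) F \<and>
      holomorphic_several F (polycap z c) \<and> (\<forall>w\<in>torus \<inter> closed_polycap z c. F w = g w)" for n
  proof -
    obtain g where g: "g \<in> {g \<in> Cp p. extends_over Q U g}"
      and gf: "\<And>w. w \<in> torus \<Longrightarrow> norm (g w - f w) < 1 / real (Suc n)"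
      using closure_of_Cp_approx[OF f, of "1 / real (Suc n)"] by auto
    have gU: "extends_over Q U g"
      using g by blast
    have "extends_over Q (halfspaces z c) g"
      by (rule extends_over_mono[OF gU _ mono]) (simp_all only: halfspaces_Int_polydisc cU)
    then show ?thesis
      using gf unfolding extends_over_def halfspaces_Int_polydisc closure_polycap[OF z c] by blast
  qed
  then obtain g F where g: "\<And>n w. w \<in> torus \<Longrightarrow> norm (g n w - f w) < 1 / real (Suc n)"
    and Q: "\<And>n. Q (closed_polycap z c) (F n)"
    and hol: "\<And>n. holomorphic_several (F n) (polycap z c)"
    and Fg: "\<And>n w. w \<in> torus \<Longrightarrow> w \<in> closed_polycap z c \<Longrightarrow> F n w = g n w"
    by (metis IntI)
  have "uniformly_Cauchy_on (closed_polycap z c') F"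
    unfolding uniformly_Cauchy_on_def dist_norm
  proof (intro allI impI)
    fix e :: real assume "0 < e"
    then obtain \<epsilon> where \<epsilon>: "0 < \<epsilon>"
      "\<And>F w. \<lbrakk>separately_continuous_on (closed_polycap z c) F;
        \<And>w. w \<in> closed_polycap z c \<Longrightarrow> norm (F w) \<le> 2 * M;
        holomorphic_several F (polycap z c);
        \<And>w. w \<in> torus \<inter> closed_polycap z c \<Longrightarrow> norm (F w) \<le> \<epsilon>;
        w \<in> closed_polycap z c'\<rbrakk> \<Longrightarrow> norm (F w) \<le> e / 2"
      using small_on_torus_imp_small[OF z c(1) c'(1,2), of "e / 2" "2 * M"] by (metis half_gt_zero)
    obtain N :: nat where N: "1 / real (Suc N) < \<epsilon> / 2"
      using \<epsilon>(1) nat_approx_posE[of "\<epsilon> / 2"] by auto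
    have "norm (F m w - F n w) < e" if mn: "m \<ge> N" "n \<ge> N" and w: "w \<in> closed_polycap z c'" for m n w
    proof -
      have "norm (F m w - F n w) \<le> e / 2"
      proof (rule \<epsilon>(2)[where F = "\<lambda>w. F m w - F n w"])
        show "separately_continuous_on (closed_polycap z c) (\<lambda>w. F m w - F n w)"
          using sep[OF Q] unfolding separately_continuous_on_def
          by (auto intro!: continuous_intros)
        show "norm (F m w - F n w) \<le> 2 * M" if "w \<in> closed_polycap z c" for w
          using norm_triangle_ineq4[of "F m w" "F n w"] bound[OF Q that, of m] bound[OF Q that, of n]
          by linarith
        show "holomorphic_several (\<lambda>w. F m w - F n w) (polycap z c)"
          unfolding holomorphic_several_def
        proof
          fix w assume "w \<in> polycap z c"
          then obtain L1 L2 where "(F m has_derivative L1) (at w)" "\<forall>c v. L1 (c *s v) = c * L1 v"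
            "(F n has_derivative L2) (at w)" "\<forall>c v. L2 (c *s v) = c * L2 v"
            using hol unfolding holomorphic_several_def by blast
          then show "\<exists>L. ((\<lambda>w. F m w - F n w) has_derivative L) (at w) \<and> (\<forall>c v. L (c *s v) = c * L v)"
            by (intro exI[of _ "\<lambda>v. L1 v - L2 v"]) (auto intro: has_derivative_diff simp: algebra_simps)
        qed
        show "norm (F m w - F n w) \<le> \<epsilon>" if "w \<in> torus \<inter> closed_polycap z c" for w
        proof -
          have w: "w \<in> torus" using that by simp
          have *: "1 / real (Suc k) \<le> 1 / real (Suc N)" if "k \<ge> N" for k
            using that by (simp add: frac_le)
          have "norm (g m w - g n w) \<le> norm (g m w - f w) + norm (g n w - f w)"
            using norm_triangle_ineq4[of "g m w - f w" "g n w - f w"] by simp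
          then show ?thesis
            using Fg[OF w, of m] Fg[OF w, of n] that g[OF w, of m] g[OF w, of n]
              *[OF mn(1)] *[OF mn(2)] N by auto
        qed
      qed (fact w)
      then show ?thesis
        using \<open>0 < e\<close> by linarith
    qed
    then show "\<exists>N. \<forall>w\<in>closed_polycap z c'. \<forall>m\<ge>N. \<forall>n\<ge>N. norm (F m w - F n w) < e"
      by blast
  qed
  then obtain G where G: "uniform_limit (closed_polycap z c') F G sequentially"
    using Cauchy_uniformly_convergent unfolding uniformly_convergent_on_def by blast
  have sub: "closed_polycap z c' \<subseteq> closed_polycap z c"
    by (rule closed_polycap_mono) (use c' in simp)
  have "extends_over Q (halfspaces z c') f"
    unfolding extends_over_def halfspaces_Int_polydisc closure_polycap[OF z c'(3,2)]
  proof (intro exI[of _ G] conjI ballI)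
    show "Q (closed_polycap z c') G"
      using lim[OF mono[OF Q sub] G] .
    show "holomorphic_several G (polycap z c')"
    proof (rule holomorphic_several_uniform_limit[OF open_polycap])
      have "polycap z c' \<subseteq> polycap z c"
        using less_trans[OF c'(1)] by (auto simp: polycap_def cap_def)
      then show "holomorphic_several (F n) (polycap z c')" for n
        using hol unfolding holomorphic_several_def by blast
      show "uniform_limit (polycap z c') F G sequentially"
        by (rule uniform_limit_on_subset[OF G polycap_subset_closed_polycap])
    qed
    fix w assume w: "w \<in> torus \<inter> closed_polycap z c'"
    have "(\<lambda>n. F n w) \<longlonglongrightarrow> G w"
      using tendsto_uniform_limitI[OF G] w by blast
    moreover have "(\<lambda>n. F n w) \<longlonglongrightarrow> f w"
    proof (rule LIM_zero_cancel, rule tendsto_norm_zero_cancel,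
        rule tendsto_sandwich[OF _ _ tendsto_const LIMSEQ_Suc[OF lim_1_over_n]])
      show "\<forall>\<^sub>F n in sequentially. norm (F n w - f w) \<le> 1 / real (Suc n)"
        using g Fg w sub by (intro always_eventually allI) (metis IntD1 IntD2 less_imp_le subsetD)
    qed simp
    ultimately show "G w = f w"
      by (rule LIMSEQ_unique)
  qed
  moreover have "z \<in> halfspaces z c'"
    using z c' by (simp add: halfspaces_def torus_def dot_square_norm)
  ultimately show ?thesis
    using open_halfspaces one_side_extendable_iff_extends_over by blast
qed

text \<open>
  Stability shrinks the domain, so it does not show that the functions with an extension of given bound
  over a given basic open set form a closed set. But the closure of this set contains extendable functions
  only, so replacing the sets by their closures does not change the union.
\<close>

lemma gdelta_nowhere_extendable:
  fixes R :: "(complex^'n) set \<Rightarrow> (complex^'n \<Rightarrow> complex) \<Rightarrow> bool"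
    and Q :: "nat \<Rightarrow> (complex^'n) set \<Rightarrow> (complex^'n \<Rightarrow> complex) \<Rightarrow> bool"
  assumes R: "\<And>S F. compact S \<Longrightarrow> R S F \<longleftrightarrow> (\<exists>M. Q M S F)"
    and bound: "\<And>M S F w. Q M S F \<Longrightarrow> w \<in> S \<Longrightarrow> norm (F w) \<le> real M"
    and sep: "\<And>M S F. Q M S F \<Longrightarrow> separately_continuous_on S F"
    and mono: "\<And>M S T F. Q M S F \<Longrightarrow> T \<subseteq> S \<Longrightarrow> Q M T F"
    and lim: "\<And>M S F G. (\<And>n. Q M S (F n)) \<Longrightarrow> uniform_limit S F G sequentially \<Longrightarrow> Q M S G"
  shows "gdelta_in (Cp_topology p) (nowhere_extendable R p)"
proof -
  have RQ: "extends_over R U f \<longleftrightarrow> (\<exists>M. extends_over (Q M) U f)" for U f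
    using R[OF compact_closure_Int_polydisc] unfolding extends_over_def by blast
  obtain \<B> :: "(complex^'n) set set" where \<B>: "countable \<B>" "topological_basis \<B>"
    using ex_countable_basis by blast
  define E where "E = (\<lambda>(M, B). Cp_topology p closure_of {g \<in> Cp p. extends_over (Q M) B g})"
  define I where "I = (UNIV :: nat set) \<times> {B \<in> \<B>. B \<inter> torus \<noteq> {}}"
  have "topspace (Cp_topology p) - nowhere_extendable R p = \<Union> (E ` I)"
  proof (intro equalityI subsetI)
    fix f assume "f \<in> topspace (Cp_topology p) - nowhere_extendable R p"
    then have f: "f \<in> Cp p" and "\<exists>z\<in>torus. one_side_extendable R f z"
      by (auto simp: nowhere_extendable_def)
    then obtain z U where z: "z \<in> torus" "open U" "z \<in> U" "extends_over R U f"
      unfolding one_side_extendable_iff_extends_over by blast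
    then obtain M where M: "extends_over (Q M) U f"
      using RQ by blast
    obtain B where B: "B \<in> \<B>" "z \<in> B" "B \<subseteq> U"
      using topological_basisE[OF \<B>(2) z(2,3)] by blast
    have "extends_over (Q M) B f"
      using B by (intro extends_over_mono[OF M _ mono]) auto
    then have "f \<in> E (M, B)"
      unfolding E_def using f closure_of_subset[of "{g \<in> Cp p. extends_over (Q M) B g}" "Cp_topology p"]
      by auto
    then show "f \<in> \<Union> (E ` I)"
      using B z by (auto simp: I_def)
  next
    fix f assume "f \<in> \<Union> (E ` I)"
    then obtain M B where MB: "B \<in> \<B>" "B \<inter> torus \<noteq> {}" "f \<in> E (M, B)"
      unfolding I_def by blast
    then obtain z where B: "B \<in> \<B>" "z \<in> B" "z \<in> torus"
      by blast
    have f: "f \<in> Cp_topology p closure_of {g \<in> Cp p. extends_over (Q M) B g}"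
      using MB(3) by (simp add: E_def)
    have "one_side_extendable (Q M) f z"
    proof (rule one_side_extendable_if_in_closure[OF _ _ _ _ _ B(2,3) f])
      show "open B"
        by (rule topological_basis_open[OF \<B>(2) B(1)])
      show "norm (F w) \<le> real M" if "Q M S F" "w \<in> S" for S F w
        using that by (rule bound)
      show "separately_continuous_on S F" if "Q M S F" for S F
        using that by (rule sep)
      show "Q M T F" if "Q M S F" "T \<subseteq> S" for S T F
        using that by (rule mono)
      show "Q M S G" if "\<And>n. Q M S (F n)" "uniform_limit S F G sequentially" for S F G
        using that by (rule lim)
    qed
    then have "one_side_extendable R f z"
      using RQ unfolding one_side_extendable_iff_extends_over by blast
    moreover have "f \<in> topspace (Cp_topology p)"
      using f by (simp add: in_closure_of)
    ultimately show "f \<in> topspace (Cp_topology p) - nowhere_extendable R p"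
      using B by (auto simp: nowhere_extendable_def)
  qed
  moreover have "fsigma_in (Cp_topology p) (\<Union> (E ` I))"
    using \<B>(1) by (intro fsigma_in_Union) (auto simp: I_def E_def intro!: closed_imp_fsigma_in)
  moreover have "nowhere_extendable R p \<subseteq> topspace (Cp_topology p)"
    by (auto simp: nowhere_extendable_def)
  ultimately show ?thesis
    by (simp add: gdelta_in_fsigma_in)
qed

lemma gdelta_nowhere_extendable_bounded_separately_continuous:
  "gdelta_in (Cp_topology p)
     (nowhere_extendable bounded_separately_continuous p :: (complex^'n \<Rightarrow> complex) set)"
proof (rule gdelta_nowhere_extendable[where
      Q = "\<lambda>M S F. (\<forall>w\<in>S. norm (F w) \<le> real M) \<and> separately_continuous_on S F"])
  fix S and F :: "complex^'n \<Rightarrow> complex"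
  have "bounded (F ` S) \<longleftrightarrow> (\<exists>M::nat. \<forall>w\<in>S. norm (F w) \<le> real M)"
  proof
    assume "bounded (F ` S)"
    then obtain b where "\<forall>w\<in>S. norm (F w) \<le> b"
      by (auto simp: bounded_iff)
    then show "\<exists>M::nat. \<forall>w\<in>S. norm (F w) \<le> real M"
      using real_arch_simple[of b] order_trans by blast
  qed (auto simp: bounded_iff)
  then show "bounded_separately_continuous S F \<longleftrightarrow>
      (\<exists>M::nat. (\<forall>w\<in>S. norm (F w) \<le> real M) \<and> separately_continuous_on S F)"
    by (auto simp: bounded_separately_continuous_iff)
next
  fix M :: nat and S T and F :: "complex^'n \<Rightarrow> complex"
  assume "(\<forall>w\<in>S. norm (F w) \<le> real M) \<and> separately_continuous_on S F" "T \<subseteq> S"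
  then show "(\<forall>w\<in>T. norm (F w) \<le> real M) \<and> separately_continuous_on T F"
    using separately_continuous_on_subset by blast
next
  fix M :: nat and S and F :: "nat \<Rightarrow> complex^'n \<Rightarrow> complex" and G
  assume "\<And>n. (\<forall>w\<in>S. norm (F n w) \<le> real M) \<and> separately_continuous_on S (F n)"
    and "uniform_limit S F G sequentially"
  then show "(\<forall>w\<in>S. norm (G w) \<le> real M) \<and> separately_continuous_on S G"
    using norm_le_uniform_limit separately_continuous_on_uniform_limit by metis
qed auto

lemma gdelta_nowhere_extendable_lipschitz_continuous:
  "gdelta_in (Cp_topology p)
     (nowhere_extendable lipschitz_continuous p :: (complex^'n \<Rightarrow> complex) set)"
proof (rule gdelta_nowhere_extendable[where
      Q = "\<lambda>M S F. (\<forall>w\<in>S. norm (F w) \<le> real M) \<and> (real M)-lipschitz_on S F"])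
  fix S :: "(complex^'n) set" and F :: "complex^'n \<Rightarrow> complex"
  assume "compact S"
  show "lipschitz_continuous S F \<longleftrightarrow>
      (\<exists>M::nat. (\<forall>w\<in>S. norm (F w) \<le> real M) \<and> (real M)-lipschitz_on S F)"
  proof
    assume "lipschitz_continuous S F"
    then obtain L where L: "L-lipschitz_on S F"
      by (auto simp: lipschitz_continuous_def)
    then have "compact (F ` S)"
      using \<open>compact S\<close> compact_continuous_image lipschitz_on_continuous_on by blast
    then obtain b where b: "\<forall>w\<in>S. norm (F w) \<le> b"
      using compact_imp_bounded[of "F ` S"] by (auto simp: bounded_iff)
    obtain M :: nat where "max b L \<le> real M"
      using real_arch_simple by blast
    then show "\<exists>M::nat. (\<forall>w\<in>S. norm (F w) \<le> real M) \<and> (real M)-lipschitz_on S F"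
      using b lipschitz_on_le[OF L] by (intro exI[of _ M]) fastforce
  qed (auto simp: lipschitz_continuous_def)
next
  fix M :: nat and S T :: "(complex^'n) set" and F :: "complex^'n \<Rightarrow> complex"
  assume "(\<forall>w\<in>S. norm (F w) \<le> real M) \<and> (real M)-lipschitz_on S F" "T \<subseteq> S"
  then show "(\<forall>w\<in>T. norm (F w) \<le> real M) \<and> (real M)-lipschitz_on T F"
    using lipschitz_on_subset by blast
next
  fix M :: nat and S :: "(complex^'n) set" and F :: "nat \<Rightarrow> complex^'n \<Rightarrow> complex" and G
  assume F: "\<And>n. (\<forall>w\<in>S. norm (F n w) \<le> real M) \<and> (real M)-lipschitz_on S (F n)"
    and lim: "uniform_limit S F G sequentially"
  have "(real M)-lipschitz_on S G"
  proof (rule lipschitz_onI)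
    fix x y assume "x \<in> S" "y \<in> S"
    show "dist (G x) (G y) \<le> real M * dist x y"
    proof (rule tendsto_upperbound)
      show "(\<lambda>n. dist (F n x) (F n y)) \<longlonglongrightarrow> dist (G x) (G y)"
        by (intro tendsto_dist tendsto_uniform_limitI[OF lim] \<open>x \<in> S\<close> \<open>y \<in> S\<close>)
      show "\<forall>\<^sub>F n in sequentially. dist (F n x) (F n y) \<le> real M * dist x y"
        using F \<open>x \<in> S\<close> \<open>y \<in> S\<close> by (intro always_eventually allI lipschitz_onD) auto
    qed simp
  qed simp
  then show "(\<forall>w\<in>S. norm (G w) \<le> real M) \<and> (real M)-lipschitz_on S G"
    using norm_le_uniform_limit[OF _ lim] F by metis
qed (auto intro: continuous_on_imp_separately_continuous_on lipschitz_on_continuous_on)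

section \<open>A lacunary series\<close>

text \<open>
  On the unit circle \<open>lacunary p (cis (- \<theta>))\<close> is the \<open>p\<close>-th derivative with respect to \<open>\<theta>\<close> of
  \<open>\<Sum>\<^sub>k exp (- \<i> 2^k \<theta>) / k!\<close>. The frequencies are lacunary, and the coefficients decay fast enough for smoothness
  but too slowly for analyticity.
\<close>

definition lacunary :: "nat \<Rightarrow> complex \<Rightarrow> complex" where
  "lacunary p w = (\<Sum>k. (- \<i> * 2 ^ k) ^ p * w ^ (2 ^ k) / fact k)"

lemma norm_lacunary_term_le:
  assumes "norm w \<le> 1"
  shows "norm ((- \<i> * 2 ^ k) ^ p * w ^ (2 ^ k) / fact k) \<le> (2 ^ p) ^ k / fact k"
proof -
  have "norm ((- \<i> * 2 ^ k) ^ p * w ^ (2 ^ k) / fact k) = (2 ^ k) ^ p * norm w ^ (2 ^ k) / fact k"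
    by (simp add: norm_mult norm_divide norm_power)
  also have "\<dots> \<le> (2 ^ k) ^ p * 1 / fact k"
    using assms by (intro divide_right_mono mult_left_mono power_le_one) auto
  finally show ?thesis
    by (simp add: power_mult[symmetric] mult.commute)
qed

lemma summable_lacunary_bound: "summable (\<lambda>k. (2 ^ p) ^ k / fact k :: real)"
  using summable_exp[of "2 ^ p :: real"] by (simp add: field_simps)

lemma summable_lacunary:
  "norm w \<le> 1 \<Longrightarrow> summable (\<lambda>k. (- \<i> * 2 ^ k) ^ p * w ^ (2 ^ k) / fact k)"
  using norm_lacunary_term_le
  by (intro summable_comparison_test'[OF summable_lacunary_bound[of p], of 0]) auto

lemma continuous_on_lacunary: "continuous_on (cball 0 1) (lacunary p)"
proof -
  have "uniform_limit (cball 0 1) (\<lambda>n w. \<Sum>k<n. (- \<i> * 2 ^ k) ^ p * w ^ (2 ^ k) / fact k)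
      (\<lambda>w. \<Sum>k. (- \<i> * 2 ^ k) ^ p * w ^ (2 ^ k) / fact k) sequentially"
    by (rule Weierstrass_m_test[OF norm_lacunary_term_le summable_lacunary_bound]) auto
  then show ?thesis
    unfolding lacunary_def[abs_def]
    by (rule uniform_limit_theorem[rotated])
       (auto intro!: always_eventually continuous_intros)
qed

lemma norm_exp_minus_ii: "norm (exp (- \<i> * \<zeta>)) \<le> 1 \<longleftrightarrow> Im \<zeta> \<le> 0"
  by simp

text \<open>
  Termwise differentiation in the coordinate \<open>\<zeta>\<close> with \<open>w = exp (- \<i> \<zeta>)\<close>, in which the closed lower
  half-plane covers the closed unit disc without its centre. The boundary line is included: there the statement gives the
  derivatives along the circle, and below the line it gives holomorphy.
\<close>

lemma has_field_derivative_lacunary: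
  assumes "Im \<zeta> \<le> 0"
  shows "((\<lambda>\<zeta>. lacunary p (exp (- \<i> * \<zeta>))) has_field_derivative lacunary (Suc p) (exp (- \<i> * \<zeta>)))
    (at \<zeta> within {\<zeta>. Im \<zeta> \<le> 0})"
proof -
  let ?S = "{\<zeta>. Im \<zeta> \<le> 0}"
  let ?f = "\<lambda>p k \<zeta>. (- \<i> * 2 ^ k) ^ p * exp (- \<i> * \<zeta>) ^ (2 ^ k) / fact k"
  have "\<exists>g. \<forall>x\<in>?S. (\<lambda>k. ?f p k x) sums g x \<and>
      (g has_field_derivative lacunary (Suc p) (exp (- \<i> * x))) (at x within ?S)"
  proof (rule has_field_derivative_series)
    show "convex ?S"
      by (rule convex_halfspace_Im_le)
    show "0 \<in> ?S"
      by simp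
    show "summable (\<lambda>k. ?f p k 0)"
      by (rule summable_lacunary) simp
    show "uniform_limit ?S (\<lambda>n x. \<Sum>k<n. ?f (Suc p) k x) (\<lambda>x. lacunary (Suc p) (exp (- \<i> * x)))
        sequentially"
      unfolding lacunary_def
      by (rule Weierstrass_m_test[OF norm_lacunary_term_le summable_lacunary_bound])
         (simp add: norm_exp_minus_ii)
    show "(?f p k has_field_derivative ?f (Suc p) k x) (at x within ?S)" for k x
    proof -
      have eq: "exp (- \<i> * \<zeta>) ^ (2 ^ k) = exp (- \<i> * 2 ^ k * \<zeta>)" for \<zeta>
        using exp_of_nat_mult[of "2 ^ k" "- \<i> * \<zeta>"] by (simp add: mult_ac)
      show ?thesis
        unfolding eq by (auto intro!: derivative_eq_intros)
    qed
  qed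
  then obtain g where g: "\<And>x. Im x \<le> 0 \<Longrightarrow> (\<lambda>k. ?f p k x) sums g x"
    and dg: "\<And>x. Im x \<le> 0 \<Longrightarrow>
      (g has_field_derivative lacunary (Suc p) (exp (- \<i> * x))) (at x within ?S)"
    by auto
  have "g x = lacunary p (exp (- \<i> * x))" if "Im x \<le> 0" for x
    using sums_unique[OF g[OF that]] by (simp add: lacunary_def)
  then show ?thesis
    using assms by (intro has_field_derivative_transform_within[OF dg zero_less_one]) auto
qed

lemma has_field_derivative_lacunary_open:
  assumes "Im \<zeta> < 0"
  shows "((\<lambda>\<zeta>. lacunary p (exp (- \<i> * \<zeta>))) has_field_derivative lacunary (Suc p) (exp (- \<i> * \<zeta>)))
    (at \<zeta>)"
proof -
  have "((\<lambda>\<zeta>. lacunary p (exp (- \<i> * \<zeta>))) has_field_derivative lacunary (Suc p) (exp (- \<i> * \<zeta>)))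
      (at \<zeta> within {\<zeta>. Im \<zeta> < 0})"
    using assms by (intro DERIV_subset[OF has_field_derivative_lacunary]) auto
  then show ?thesis
    using assms at_within_open[OF _ open_halfspace_Im_lt, of \<zeta> 0] by simp
qed

text \<open>
  If \<open>w^(2^k) = 1\<close> for \<open>k \<ge> m\<close>, the terms from \<open>m\<close> on are non-negative multiples of \<open>(- \<i>)^p\<close> and cannot
  cancel, so any one of them is a lower bound up to the first \<open>m\<close> terms.
\<close>

lemma norm_lacunary_ge:
  assumes w: "norm w = 1" and m: "\<And>k. m \<le> k \<Longrightarrow> w ^ (2 ^ k) = 1" and K: "m \<le> K"
  shows "(2 ^ K) ^ p / fact K - real m * (2 ^ m) ^ p \<le> norm (lacunary p w)"
proof -
  define x where "x k = (2 ^ k) ^ p * w ^ (2 ^ k) / fact k" for k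
  have split: "(- \<i> * 2 ^ k) ^ p * w ^ (2 ^ k) / fact k = (- \<i>) ^ p * x k" for k
    unfolding x_def power_mult_distrib by simp
  have sx: "summable x"
  proof (rule summable_comparison_test'[OF summable_lacunary_bound[of p], of 0])
    show "norm (x k) \<le> (2 ^ p) ^ k / fact k" for k
      using norm_lacunary_term_le[of w k p] w unfolding split by (simp add: norm_mult norm_power)
  qed
  have "lacunary p w = (- \<i>) ^ p * suminf x"
    unfolding lacunary_def split by (rule suminf_mult[OF sx])
  then have n: "norm (lacunary p w) = norm (suminf x)"
    by (simp add: norm_mult norm_power)
  have "suminf x = (\<Sum>k. x (k + m)) + (\<Sum>k<m. x k)"
    by (rule suminf_split_initial_segment[OF sx])
  then have 1: "norm (\<Sum>k. x (k + m)) - norm (\<Sum>k<m. x k) \<le> norm (suminf x)"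
    using norm_diff_ineq[of "\<Sum>k. x (k + m)" "\<Sum>k<m. x k"] by simp
  have "norm (x k) \<le> (2 ^ m) ^ p" if "k < m" for k
  proof -
    have "norm (x k) = (2 ^ k) ^ p / fact k"
      using w by (simp add: x_def norm_mult norm_divide norm_power)
    also have "\<dots> \<le> (2 ^ k) ^ p / 1"
      by (intro divide_left_mono) auto
    also have "\<dots> \<le> (2 ^ m) ^ p"
      using that by (simp add: power_mono)
    finally show ?thesis .
  qed
  then have 2: "norm (\<Sum>k<m. x k) \<le> real m * (2 ^ m) ^ p"
    using sum_norm_bound[of "{..<m}" x "(2 ^ m) ^ p"] by simp
  have s: "summable (\<lambda>k. x (k + m))"
    using sx by simp
  have re: "Re (x (k + m)) = (2 ^ (k + m)) ^ p / fact (k + m)" for k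
  proof -
    have "x (k + m) = of_real ((2 ^ (k + m)) ^ p / fact (k + m))"
      unfolding x_def using m[of "k + m"] by simp
    then show ?thesis
      by (simp only: Re_complex_of_real)
  qed
  have "Re (x (K - m + m)) = (\<Sum>k\<in>{K - m}. Re (x (k + m)))"
    by simp
  also have "\<dots> \<le> (\<Sum>k. Re (x (k + m)))"
    by (rule sum_le_suminf[OF summable_Re[OF s]]) (auto simp: re)
  also have "\<dots> = Re (\<Sum>k. x (k + m))"
    by (rule bounded_linear.suminf[OF bounded_linear_Re s, symmetric])
  also have "\<dots> \<le> norm (\<Sum>k. x (k + m))"
    by (rule complex_Re_le_cmod)
  finally have "(2 ^ K) ^ p / fact K \<le> norm (\<Sum>k. x (k + m))"
    using re[of "K - m"] K by simp
  then show ?thesis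
    using 1 2 n by linarith
qed

text \<open>
  Multiplying by \<open>(\<rho> / 2)^p / p!\<close> and summing over \<open>p\<close> turns the inequalities into
  \<open>exp (2^K \<rho> / 2) / K! \<le> m exp (2^m \<rho> / 2) + 2 B\<close>, where the right side does not depend on \<open>K\<close>.
\<close>

lemma factorial_growth_contradiction:
  fixes B \<rho> :: real
  assumes \<rho>: "0 < \<rho>"
    and le: "\<And>K p. m \<le> K \<Longrightarrow> (2 ^ K) ^ p / fact K \<le> real m * (2 ^ m) ^ p + fact p * B / \<rho> ^ p"
  shows False
proof -
  define x where "x = \<rho> / 2"
  have x: "0 < x"
    using \<rho> by (simp add: x_def)
  have exp_le: "exp (2 ^ K * x) / fact K \<le> real m * exp (2 ^ m * x) + B * 2" if K: "m \<le> K" for K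
  proof (rule sums_le)
    have e: "(\<lambda>p. y ^ p / fact p) sums exp y" for y :: real
      using exp_converges[of y] by (simp add: field_simps)
    show "(\<lambda>p. (2 ^ K * x) ^ p / fact p / fact K) sums (exp (2 ^ K * x) / fact K)"
      by (intro sums_divide e)
    have "(\<lambda>p. (1 / 2) ^ p) sums (1 / (1 - 1 / 2 :: real))"
      by (rule geometric_sums) simp
    then have "(\<lambda>p. (1 / 2) ^ p) sums (2 :: real)"
      by simp
    then show "(\<lambda>p. real m * ((2 ^ m * x) ^ p / fact p) + B * (1 / 2) ^ p) sums
        (real m * exp (2 ^ m * x) + B * 2)"
      by (intro sums_add sums_mult e)
    fix p
    have "(2 ^ K) ^ p / fact K * (x ^ p / fact p) \<le>
        (real m * (2 ^ m) ^ p + fact p * B / \<rho> ^ p) * (x ^ p / fact p)"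
      using x by (intro mult_right_mono le K) auto
    also have "\<dots> = real m * ((2 ^ m * x) ^ p / fact p) + B * (x / \<rho>) ^ p"
      using \<rho> by (simp add: field_simps power_mult_distrib)
    also have "x / \<rho> = 1 / 2"
      using \<rho> by (simp add: x_def)
    finally show "(2 ^ K * x) ^ p / fact p / fact K \<le>
        real m * ((2 ^ m * x) ^ p / fact p) + B * (1 / 2) ^ p"
      by (simp add: power_mult_distrib mult_ac)
  qed
  have "filterlim (\<lambda>K::nat. exp (2 ^ K * x) / real K ^ K) at_top at_top"
    using x by real_asymp
  then obtain N where N: "\<And>K. N \<le> K \<Longrightarrow>
      real m * exp (2 ^ m * x) + B * 2 + 1 \<le> exp (2 ^ K * x) / real K ^ K"
    unfolding filterlim_at_top eventually_sequentially by blast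
  define K where "K = Suc (max N m)"
  have "exp (2 ^ K * x) / real K ^ K \<le> exp (2 ^ K * x) / fact K"
  proof (rule divide_left_mono)
    show "fact K \<le> real K ^ K"
      using fact_le_power[of K, where 'a = real] by simp
    have "0 < real K"
      by (simp add: K_def)
    then show "0 < real K ^ K * fact K"
      by simp
  qed simp
  also have "\<dots> \<le> real m * exp (2 ^ m * x) + B * 2"
    by (rule exp_le) (simp add: K_def)
  finally have "exp (2 ^ K * x) / real K ^ K \<le> real m * exp (2 ^ m * x) + B * 2" .
  moreover have "N \<le> K"
    by (simp add: K_def)
  ultimately show False
    using N[of K] by linarith
qed

text \<open>
  Rounding \<open>\<theta>\<close> to a multiple of \<open>2 \<pi> / 2^m\<close> makes \<open>exp (- \<i> \<theta>\<^sub>0)\<close> a root of unity of order dividing \<open>2^m\<close>.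
\<close>

lemma dyadic_angle_dense:
  fixes \<theta> :: real
  assumes "0 < d"
  obtains \<theta>0 m where "\<bar>\<theta>0 - \<theta>\<bar> < d" "\<And>k. m \<le> k \<Longrightarrow> exp (- \<i> * of_real \<theta>0) ^ (2 ^ k) = 1"
proof -
  obtain m :: nat where m: "2 * pi / d < 2 ^ m"
    using real_arch_pow[of 2 "2 * pi / d"] by auto
  define q where "q = \<lfloor>\<theta> * 2 ^ m / (2 * pi)\<rfloor>"
  define \<theta>0 where "\<theta>0 = 2 * pi * of_int q / 2 ^ m"
  have "\<bar>of_int q - \<theta> * 2 ^ m / (2 * pi)\<bar> < 1"
    unfolding q_def by linarith
  moreover have "\<bar>\<theta>0 - \<theta>\<bar> = 2 * pi / 2 ^ m * \<bar>of_int q - \<theta> * 2 ^ m / (2 * pi)\<bar>"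
  proof -
    have "\<theta>0 - \<theta> = 2 * pi / 2 ^ m * (of_int q - \<theta> * 2 ^ m / (2 * pi))"
      by (simp add: \<theta>0_def field_simps)
    then show ?thesis
      by (simp add: abs_mult)
  qed
  ultimately have "\<bar>\<theta>0 - \<theta>\<bar> < 2 * pi / 2 ^ m * 1"
    by (metis mult_less_cancel_left_pos pi_gt_zero zero_less_divide_iff zero_less_mult_iff
        zero_less_numeral zero_less_power)
  also have "2 * pi / 2 ^ m < d"
    using m assms by (simp add: field_simps)
  finally have 1: "\<bar>\<theta>0 - \<theta>\<bar> < d"
    by simp
  have "exp (- \<i> * of_real \<theta>0) ^ (2 ^ k) = 1" if "m \<le> k" for k
  proof -
    have "(2 ^ k :: real) = 2 ^ (k - m) * 2 ^ m"
      using that by (simp add: power_add[symmetric])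
    then have "2 ^ k * \<theta>0 = 2 * pi * of_int (2 ^ (k - m) * q)"
      by (simp add: \<theta>0_def)
    then have eq: "(2 ^ k :: complex) * of_real \<theta>0 = of_real (2 * pi * of_int (2 ^ (k - m) * q))"
      by (metis of_real_mult of_real_numeral of_real_power)
    have "exp (- \<i> * of_real \<theta>0) ^ (2 ^ k) = exp (- \<i> * ((2 ^ k :: complex) * of_real \<theta>0))"
      using exp_of_nat_mult[of "2 ^ k" "- \<i> * of_real \<theta>0"] by (simp add: mult_ac)
    also have "\<dots> = exp ((2 * of_int (- (2 ^ (k - m) * q)) * of_real pi) * \<i>)"
      unfolding eq by (simp add: mult_ac)
    also have "\<dots> = 1"
      using exp_integer_2pi[OF Ints_of_int, of "- (2 ^ (k - m) * q)"] by (simp add: mult_ac)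
    finally show ?thesis .
  qed
  with 1 that show ?thesis
    by blast
qed

text \<open>
  In the coordinate \<open>\<zeta>\<close> with \<open>s = exp (\<i> \<zeta>)\<close> the circle is the real line and the disc lies above it. Below
  it the series is holomorphic, since \<open>cnj s = exp (- \<i> \<zeta>)\<close> for real \<open>\<zeta>\<close>. Both pieces agree on the line and glue
  to a holomorphic function \<open>H\<close> near a dyadic angle \<open>\<theta>\<^sub>0\<close>. Its derivatives at \<open>\<theta>\<^sub>0\<close> are limits of
  those from below, hence given by the series, and they violate Cauchy's inequality.
\<close>

lemma lacunary_not_extendable_on_cap:
  assumes a: "norm a = 1" and c: "0 < c" "c < 1"
    and cont: "continuous_on (closed_cap a c) \<phi>" and hol: "\<phi> holomorphic_on cap a c"
    and bd: "\<And>s. s \<in> closed_cap a c \<Longrightarrow> norm s = 1 \<Longrightarrow> \<phi> s = lacunary 0 (cnj s)"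
  shows False
proof -
  let ?W = "{\<zeta>. c < a \<bullet> exp (\<i> * \<zeta>)}"
  have oW: "open ?W"
    by (intro open_Collect_less continuous_intros)
  have "of_real (Arg a) \<in> ?W"
  proof -
    have "exp (\<i> * of_real (Arg a)) = a"
      using a Arg_eq[of a] by (metis mult_1 norm_zero of_real_1 zero_neq_one)
    then show ?thesis
      using a c by (simp add: dot_square_norm)
  qed
  then obtain d where d: "0 < d" "ball (of_real (Arg a)) d \<subseteq> ?W"
    using oW openE by blast
  obtain \<theta>0 m where \<theta>0: "\<bar>\<theta>0 - Arg a\<bar> < d"
    and m: "\<And>k. m \<le> k \<Longrightarrow> exp (- \<i> * of_real \<theta>0) ^ (2 ^ k) = 1"
    using dyadic_angle_dense[OF d(1), of "Arg a"] by blast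
  have "dist (of_real (Arg a) :: complex) (of_real \<theta>0) < d"
    using \<theta>0 by (metis abs_minus_commute dist_of_real dist_real_def)
  then have "of_real \<theta>0 \<in> ?W"
    using d(2) by (auto simp: subset_iff)
  then obtain r where r: "0 < r" "ball (of_real \<theta>0) r \<subseteq> ?W"
    using oW openE by blast
  let ?S = "ball (of_real \<theta>0) r :: complex set"
  have cap: "exp (\<i> * \<zeta>) \<in> cap a c" if "\<zeta> \<in> ?S" "0 < Im \<zeta>" for \<zeta>
    using that r(2) by (auto simp: cap_def)
  have ccap: "exp (\<i> * \<zeta>) \<in> closed_cap a c" if "\<zeta> \<in> ?S" "0 \<le> Im \<zeta>" for \<zeta>
    using that r(2) by (force simp: closed_cap_def)
  define H where "H \<zeta> = (if Im \<zeta> \<le> 0 then lacunary 0 (exp (- \<i> * \<zeta>)) else \<phi> (exp (\<i> * \<zeta>)))" for \<zeta>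
  have dlow: "((\<lambda>\<zeta>. lacunary p (exp (- \<i> * \<zeta>))) has_field_derivative lacunary (Suc p) (exp (- \<i> * \<zeta>)))
      (at \<zeta>)" if "\<zeta> \<in> ?S \<inter> {\<zeta>. Im \<zeta> < 0}" for p \<zeta>
    using that has_field_derivative_lacunary_open by auto
  have olow: "open (?S \<inter> {\<zeta>. Im \<zeta> < 0})"
    by (intro open_Int open_ball open_halfspace_Im_lt)
  have clow: "continuous_on {\<zeta>. Im \<zeta> \<le> 0} (\<lambda>\<zeta>. lacunary p (exp (- \<i> * \<zeta>)))" for p
    by (rule continuous_on_compose2[OF continuous_on_lacunary]) (auto intro!: continuous_intros)
  have Hcont: "continuous_on ?S H"
    unfolding H_def
  proof (rule continuous_on_cases_le)
    show "continuous_on {\<zeta> \<in> ?S. Im \<zeta> \<le> 0} (\<lambda>\<zeta>. lacunary 0 (exp (- \<i> * \<zeta>)))"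
      by (rule continuous_on_subset[OF clow]) auto
    show "continuous_on {\<zeta> \<in> ?S. 0 \<le> Im \<zeta>} (\<lambda>\<zeta>. \<phi> (exp (\<i> * \<zeta>)))"
      by (rule continuous_on_compose2[OF cont]) (use ccap in \<open>auto intro!: continuous_intros\<close>)
    show "continuous_on ?S Im"
      by (intro continuous_intros)
    show "lacunary 0 (exp (- \<i> * \<zeta>)) = \<phi> (exp (\<i> * \<zeta>))" if "\<zeta> \<in> ?S" "Im \<zeta> = 0" for \<zeta>
    proof -
      have "\<zeta> = of_real (Re \<zeta>)"
        using that(2) by (simp add: complex_eq_iff)
      then have "cnj (exp (\<i> * \<zeta>)) = exp (- \<i> * \<zeta>)"
        by (metis complex_cnj_complex_of_real complex_cnj_i complex_cnj_mult exp_cnj)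
      then show ?thesis
        using bd[OF ccap[OF that(1)]] that(2) by simp
    qed
  qed
  have Hhol: "H holomorphic_on ?S"
  proof (rule holomorphic_on_paste_across_line[OF open_ball, of \<i> _ _ _ 0])
    have "(\<lambda>\<zeta>. lacunary 0 (exp (- \<i> * \<zeta>))) holomorphic_on ?S \<inter> {\<zeta>. Im \<zeta> < 0}"
      unfolding holomorphic_on_open[OF olow] using dlow by blast
    then have "H holomorphic_on ?S \<inter> {\<zeta>. Im \<zeta> < 0}"
      by (rule holomorphic_transform) (auto simp: H_def)
    then show "H holomorphic_on ?S \<inter> {z. \<i> \<bullet> z < 0}"
      by (simp add: inner_complex_def)
    have "(\<lambda>\<zeta>. \<phi> (exp (\<i> * \<zeta>))) holomorphic_on ?S \<inter> {\<zeta>. 0 < Im \<zeta>}"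
      using cap by (intro holomorphic_on_compose_gen[OF _ hol, unfolded o_def] holomorphic_intros) auto
    then have "H holomorphic_on ?S \<inter> {\<zeta>. 0 < Im \<zeta>}"
      by (rule holomorphic_transform) (auto simp: H_def)
    then show "H holomorphic_on ?S \<inter> {z. 0 < \<i> \<bullet> z}"
      by (simp add: inner_complex_def)
  qed (use Hcont in auto)
  have Hlow: "(deriv ^^ p) H \<zeta> = lacunary p (exp (- \<i> * \<zeta>))" if "\<zeta> \<in> ?S \<inter> {\<zeta>. Im \<zeta> < 0}" for p \<zeta>
    using that
  proof (induction p arbitrary: \<zeta>)
    case 0
    then show ?case by (simp add: H_def)
  next
    case (Suc p)
    have "((deriv ^^ p) H has_field_derivative lacunary (Suc p) (exp (- \<i> * \<zeta>))) (at \<zeta>)"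
      using has_field_derivative_transform_within_open[OF dlow[OF Suc.prems] olow Suc.prems] Suc.IH
      by metis
    then show ?case
      by (simp add: DERIV_imp_deriv)
  qed
  define w0 where "w0 = exp (- \<i> * of_real \<theta>0)"
  have H0: "(deriv ^^ p) H (of_real \<theta>0) = lacunary p w0" for p
  proof -
    define \<zeta> where "\<zeta> n = of_real \<theta>0 - \<i> * of_real (r / 2 * (1 / real (Suc n)))" for n
    have "(\<lambda>n. of_real \<theta>0 - \<i> * of_real (r / 2 * (1 / real (Suc n)))) \<longlonglongrightarrow>
        of_real \<theta>0 - \<i> * of_real (r / 2 * 0)"
      by (intro tendsto_intros LIMSEQ_Suc[OF lim_1_over_n])
    then have lim: "\<zeta> \<longlonglongrightarrow> of_real \<theta>0"
      unfolding \<zeta>_def by simp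
    have in_low: "\<zeta> n \<in> ?S \<inter> {\<zeta>. Im \<zeta> < 0}" for n
    proof -
      have "dist (of_real \<theta>0) (\<zeta> n) = r / 2 * (1 / real (Suc n))"
        using r by (simp add: \<zeta>_def dist_norm norm_mult norm_divide del: of_nat_Suc)
      also have "\<dots> \<le> r / 2 * 1"
        using r by (intro mult_left_mono) auto
      also have "\<dots> < r"
        using r by simp
      finally show ?thesis
        using r by (simp add: \<zeta>_def)
    qed
    have "continuous_on ?S ((deriv ^^ p) H)"
      by (intro holomorphic_on_imp_continuous_on holomorphic_higher_deriv Hhol open_ball)
    then have 1: "(\<lambda>n. (deriv ^^ p) H (\<zeta> n)) \<longlonglongrightarrow> (deriv ^^ p) H (of_real \<theta>0)"
      using in_low r by (intro continuous_on_tendsto_compose[OF _ lim]) auto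
    have 2: "(\<lambda>n. lacunary p (exp (- \<i> * \<zeta> n))) \<longlonglongrightarrow> lacunary p w0"
      unfolding w0_def using in_low
      by (intro continuous_on_tendsto_compose[OF clow lim]) (auto simp: less_imp_le)
    have "(\<lambda>n. (deriv ^^ p) H (\<zeta> n)) = (\<lambda>n. lacunary p (exp (- \<i> * \<zeta> n)))"
      by (intro ext Hlow in_low)
    then show ?thesis
      using LIMSEQ_unique[OF 1] 2 by simp
  qed
  define \<rho> where "\<rho> = r / 2"
  have \<rho>: "0 < \<rho>" and sub: "cball (of_real \<theta>0) \<rho> \<subseteq> ?S"
    using r by (auto simp: \<rho>_def)
  have Hc: "continuous_on (cball (of_real \<theta>0) \<rho>) H"
    using Hcont sub continuous_on_subset by blast
  then have "bounded (H ` cball (of_real \<theta>0) \<rho>)"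
    by (intro compact_imp_bounded compact_continuous_image) auto
  then obtain B where B: "\<And>\<zeta>. \<zeta> \<in> cball (of_real \<theta>0) \<rho> \<Longrightarrow> norm (H \<zeta>) \<le> B"
    unfolding bounded_iff by blast
  have upper: "norm (lacunary p w0) \<le> fact p * B / \<rho> ^ p" for p
    unfolding H0[symmetric]
  proof (rule Cauchy_inequality[OF _ Hc \<rho>])
    show "H holomorphic_on ball (of_real \<theta>0) \<rho>"
      using Hhol sub by (meson ball_subset_cball holomorphic_on_subset order_trans)
    show "norm (H x) \<le> B" if "norm (of_real \<theta>0 - x) = \<rho>" for x
      using that by (intro B) (simp add: dist_norm)
  qed
  have w0: "norm w0 = 1"
    by (simp add: w0_def)
  have "(2 ^ K) ^ p / fact K \<le> real m * (2 ^ m) ^ p + fact p * B / \<rho> ^ p" if "m \<le> K" for K p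
    using norm_lacunary_ge[OF w0 m[folded w0_def] that, of p] upper[of p] by linarith
  then show False
    using factorial_growth_contradiction[OF \<rho>] by blast
qed

section \<open>A nowhere extendable smooth function\<close>

definition lacunary_coord :: "'n \<Rightarrow> complex^'n \<Rightarrow> complex" where
  "lacunary_coord i = restrict (\<lambda>z. lacunary 0 (cnj (z $ i))) torus"

text \<open>
  The chain rule for the path \<open>t \<mapsto> t + \<theta>\<close> in the boundary of the half-plane, where \<open>s = cis \<theta>\<close>.
\<close>

lemma has_vector_derivative_lacunary_rotation:
  assumes "norm s = 1"
  shows "((\<lambda>t. lacunary p (cnj (cis t * s))) has_vector_derivative lacunary (Suc p) (cnj s)) (at 0)"
proof -
  define \<theta> where "\<theta> = Arg s"
  have s: "s = cis \<theta>"
    using assms cis_Arg_unique[of s] rcis_cmod_Arg[of s] by (simp add: \<theta>_def rcis_def)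
  have e: "cnj (cis t * s) = exp (- \<i> * of_real (t + \<theta>))" for t
  proof -
    have "cnj (cis t * s) = cis (- (t + \<theta>))"
      unfolding s cis_mult cis_cnj ..
    then show ?thesis
      by (simp only: cis_conv_exp of_real_minus mult_minus_left mult_minus_right)
  qed
  let ?f = "\<lambda>t. complex_of_real (t + \<theta>)"
  have "((\<lambda>\<zeta>. lacunary p (exp (- \<i> * \<zeta>))) \<circ> ?f has_vector_derivative
      1 * lacunary (Suc p) (exp (- \<i> * ?f 0))) (at 0 within UNIV)"
  proof (rule field_vector_diff_chain_within)
    show "(?f has_vector_derivative 1) (at 0 within UNIV)"
      by (auto intro!: derivative_eq_intros simp: has_vector_derivative_def scaleR_conv_of_real)
    show "((\<lambda>\<zeta>. lacunary p (exp (- \<i> * \<zeta>))) has_field_derivative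
        lacunary (Suc p) (exp (- \<i> * ?f 0))) (at (?f 0) within range ?f)"
      by (rule DERIV_subset[OF has_field_derivative_lacunary]) auto
  qed
  moreover have "exp (- \<i> * ?f 0) = cnj s"
    using e[of 0] by simp
  ultimately show ?thesis
    unfolding e o_def by simp
qed

lemma iter_partial_lacunary_coord:
  "iter_partial_exists js (lacunary_coord i) \<and>
   (\<forall>z\<in>torus. iter_partial js (lacunary_coord i) z =
      (if set js \<subseteq> {i} then lacunary (length js) (cnj (z $ i)) else 0))"
proof (induction js)
  case Nil
  then show ?case
    by (simp add: lacunary_coord_def)
next
  case (Cons j js)
  let ?v = "\<lambda>js z. if set js \<subseteq> {i} then lacunary (length js) (cnj (z $ i)) else 0"
  have D: "((\<lambda>t. iter_partial js (lacunary_coord i) (rotate_coord j t z)) has_vector_derivative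
      ?v (j # js) z) (at 0)" if z: "z \<in> torus" for z
  proof -
    have eq: "iter_partial js (lacunary_coord i) (rotate_coord j t z) = ?v js (rotate_coord j t z)"
      for t
      using Cons rotate_coord_in_torus[OF z] by blast
    show ?thesis
    proof (cases "j = i \<and> set js \<subseteq> {i}")
      case True
      have "norm (z $ i) = 1"
        using z by (simp add: torus_def)
      from has_vector_derivative_lacunary_rotation[OF this, of "length js"] show ?thesis
        unfolding eq using True by (simp add: rotate_coord_def set_coord_def)
    next
      case False
      then have "?v js (rotate_coord j t z) = ?v js z" for t
        by (auto simp: rotate_coord_def set_coord_def)
      then show ?thesis
        unfolding eq using False by auto
    qed
  qed
  show ?case
    unfolding iter_partial_exists.simps iter_partial_Cons
    using Cons by (intro conjI ballI differentiableI_vector[OF D] vector_derivative_at[OF D]) auto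
qed

lemma lacunary_coord_in_Cp: "lacunary_coord i \<in> Cp p"
proof -
  have "continuous_on torus (iter_partial js (lacunary_coord i))" for js
  proof -
    let ?v = "\<lambda>z. if set js \<subseteq> {i} then lacunary (length js) (cnj (z $ i)) else 0"
    have "continuous_on torus (\<lambda>z. lacunary (length js) (cnj (z $ i)))"
      by (rule continuous_on_compose2[OF continuous_on_lacunary])
         (auto intro!: continuous_intros simp: torus_def)
    then have "continuous_on torus ?v"
      by (cases "set js \<subseteq> {i}") (simp_all only: if_True if_False simp_thms continuous_on_const)
    then show ?thesis
      by (rule continuous_on_eq)
        (rule iter_partial_lacunary_coord[THEN conjunct2, THEN bspec, symmetric])
  qed
  then show ?thesis
    using iter_partial_lacunary_coord[of _ i] by (simp add: Cp_def lacunary_coord_def)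
qed

text \<open>
  An extension at \<open>z\<close> restricts to a slice in the \<open>i\<close>-th variable with the other coordinates of \<open>z\<close> on the
  circle. This slice is continuous up to the arc and holomorphic by \<open>slice_holomorphic\<close>, so it would
  extend the lacunary series.
\<close>

lemma lacunary_coord_nowhere_extendable:
  "lacunary_coord i \<in> nowhere_extendable bounded_separately_continuous p"
proof -
  have False if z: "z \<in> torus" and U: "open U" "z \<in> U"
    and ext: "extends_over bounded_separately_continuous U (lacunary_coord i)" for z U
  proof -
    obtain c where c: "0 < c" "c < 1" "polycap z c \<subseteq> U"
      using exists_polycap_subset[OF U z] by blast
    have "extends_over bounded_separately_continuous (halfspaces z c) (lacunary_coord i)"
      by (rule extends_over_mono[OF ext _ bounded_separately_continuous_subset])
         (simp_all only: halfspaces_Int_polydisc c)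
    then obtain F where F: "bounded_separately_continuous (closed_polycap z c) F"
      and hol: "holomorphic_several F (polycap z c)"
      and bd: "\<And>w. w \<in> torus \<Longrightarrow> w \<in> closed_polycap z c \<Longrightarrow> F w = lacunary_coord i w"
      unfolding extends_over_def halfspaces_Int_polydisc closure_polycap[OF z c(1,2)] by blast
    obtain M where M: "\<And>w. w \<in> closed_polycap z c \<Longrightarrow> norm (F w) \<le> M"
      using F by (auto simp: bounded_separately_continuous_iff bounded_iff)
    have sep: "separately_continuous_on (closed_polycap z c) F"
      using F by (simp add: bounded_separately_continuous_iff)
    have zc: "z \<in> closed_polycap z c"
      using z c by (simp add: closed_polycap_def closed_cap_def torus_def dot_square_norm)
    have z1: "norm (z $ k) = 1" for k
      using z by (simp add: torus_def)
    show False
    proof (rule lacunary_not_extendable_on_cap[OF z1 c(1,2)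
          slice_continuous[OF sep zc] slice_holomorphic[OF z c(1,2) sep M hol zc]])
      fix s assume s: "s \<in> closed_cap (z $ i) c" "norm s = 1"
      have "set_coord i s z \<in> torus"
        using z s by (simp add: torus_def)
      then show "F (set_coord i s z) = lacunary 0 (cnj s)"
        using bd[OF _ set_coord_in_closed_polycap[OF zc s(1)]] by (simp add: lacunary_coord_def)
    qed
  qed
  then show ?thesis
    unfolding nowhere_extendable_def one_side_extendable_iff_extends_over
    using lacunary_coord_in_Cp by blast
qed

section \<open>Density\<close>

lemma extends_over_scaled_difference:
  fixes k :: complex
  assumes f: "extends_over bounded_separately_continuous U f"
    and g: "extends_over bounded_separately_continuous U g"
    and h: "\<And>w. w \<in> torus \<Longrightarrow> h w = k * (f w - g w)"
  shows "extends_over bounded_separately_continuous U h"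
proof -
  let ?S = "closure (U \<inter> polydisc)"
  obtain F G where F: "bounded_separately_continuous ?S F" "holomorphic_several F (U \<inter> polydisc)"
      "\<forall>w\<in>torus \<inter> ?S. F w = f w"
    and G: "bounded_separately_continuous ?S G" "holomorphic_several G (U \<inter> polydisc)"
      "\<forall>w\<in>torus \<inter> ?S. G w = g w"
    using f g unfolding extends_over_def by blast
  have "bounded ((\<lambda>w. k * (F w - G w)) ` ?S)"
  proof -
    obtain b1 b2 where b: "\<forall>w\<in>?S. norm (F w) \<le> b1" "\<forall>w\<in>?S. norm (G w) \<le> b2"
      using F(1) G(1) by (auto simp: bounded_separately_continuous_def bounded_iff)
    show ?thesis
    proof (rule boundedI, safe)
      fix w assume "w \<in> ?S"
      then have "norm (F w - G w) \<le> b1 + b2"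
        using b norm_triangle_ineq4[of "F w" "G w"] by fastforce
      then show "norm (k * (F w - G w)) \<le> norm k * (b1 + b2)"
        by (simp add: norm_mult mult_left_mono)
    qed
  qed
  then have "bounded_separately_continuous ?S (\<lambda>w. k * (F w - G w))"
    using F(1) G(1) unfolding bounded_separately_continuous_def
    by (auto intro!: continuous_intros)
  moreover have "holomorphic_several (\<lambda>w. k * (F w - G w)) (U \<inter> polydisc)"
    unfolding holomorphic_several_def
  proof
    fix w assume "w \<in> U \<inter> polydisc"
    then obtain L1 L2 where "(F has_derivative L1) (at w)" "\<forall>c v. L1 (c *s v) = c * L1 v"
      "(G has_derivative L2) (at w)" "\<forall>c v. L2 (c *s v) = c * L2 v"
      using F(2) G(2) unfolding holomorphic_several_def by blast
    then show "\<exists>L. ((\<lambda>w. k * (F w - G w)) has_derivative L) (at w) \<and> (\<forall>c v. L (c *s v) = c * L v)"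
      by (intro exI[of _ "\<lambda>v. k * (L1 v - L2 v)"])
         (auto intro!: derivative_eq_intros simp: algebra_simps)
  qed
  ultimately show ?thesis
    using F(3) G(3) h unfolding extends_over_def by (intro exI[of _ "\<lambda>w. k * (F w - G w)"]) auto
qed

text \<open>
  The pigeonhole argument on the line \<open>f + t h\<close>: a map from an interval of parameters \<open>t\<close> to a countable
  basis is not injective.
\<close>

lemma dense_nowhere_extendable:
  fixes h :: "complex^'n \<Rightarrow> complex"
  assumes hU: "h \<in> nowhere_extendable bounded_separately_continuous p"
  shows "Cp_topology p closure_of nowhere_extendable bounded_separately_continuous p =
    topspace (Cp_topology p :: (complex^'n \<Rightarrow> complex) topology)"
proof (intro equalityI subsetI closure_of_subset_topspace[THEN subsetD])
  have h: "h \<in> Cp p"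
    using hU by (simp add: nowhere_extendable_def)
  fix f :: "complex^'n \<Rightarrow> complex" assume "f \<in> topspace (Cp_topology p)"
  then have f: "f \<in> Cp p" by simp
  define line where "line t = restrict (\<lambda>z. f z + of_real t * h z) torus" for t :: real
  have "\<exists>g\<in>nowhere_extendable bounded_separately_continuous p. g \<in> T"
    if T: "openin (Cp_topology p) T" "f \<in> T" for T
  proof (rule ccontr)
    assume none: "\<not> ?thesis"
    have "openin euclideanreal {t \<in> topspace euclideanreal. line t \<in> T}"
      unfolding line_def by (rule openin_continuous_map_preimage[OF continuous_map_line_Cp[OF f h] T(1)])
    then have "open {t. line t \<in> T}"
      by (simp only: open_openin topspace_euclidean UNIV_I simp_thms)
    moreover have "line 0 = f"
      using f by (auto simp: line_def Cp_def extensional_def)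
    ultimately obtain d where d: "0 < d" "ball 0 d \<subseteq> {t. line t \<in> T}"
      using T(2) openE[of "{t. line t \<in> T}" 0] by auto
    obtain \<B> :: "(complex^'n) set set" where \<B>: "countable \<B>" "topological_basis \<B>"
      using ex_countable_basis by blast
    have "\<exists>B\<in>\<B>. B \<inter> torus \<noteq> {} \<and> extends_over bounded_separately_continuous B (line t)"
      if t: "t \<in> ball 0 d" for t
    proof -
      have "line t \<in> T" "line t \<in> Cp p"
        using d t Cp_lincomb[OF f h] by (auto simp: line_def)
      then obtain z U where z: "z \<in> torus" "open U" "z \<in> U"
        "extends_over bounded_separately_continuous U (line t)"
        using none unfolding nowhere_extendable_def one_side_extendable_iff_extends_over by blast
      obtain B where B: "B \<in> \<B>" "z \<in> B" "B \<subseteq> U"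
        using topological_basisE[OF \<B>(2) z(2,3)] by blast
      have "extends_over bounded_separately_continuous B (line t)"
        by (rule extends_over_mono[OF z(4) _ bounded_separately_continuous_subset]) (use B in auto)
      then show ?thesis
        using B z(1) by blast
    qed
    then obtain B where B: "\<And>t. t \<in> ball 0 d \<Longrightarrow> B t \<in> \<B>" "\<And>t. t \<in> ball 0 d \<Longrightarrow> B t \<inter> torus \<noteq> {}"
      "\<And>t. t \<in> ball 0 d \<Longrightarrow> extends_over bounded_separately_continuous (B t) (line t)"
      by metis
    have "\<not> inj_on B (ball 0 d)"
    proof
      assume "inj_on B (ball 0 d)"
      moreover have "countable (B ` ball 0 d)"
        using B(1) \<B>(1) by (meson countable_subset image_subsetI)
      ultimately show False
        using countable_image_inj_on uncountable_ball[OF d(1)] by blast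
    qed
    then obtain t t' where t: "t \<in> ball 0 d" "t' \<in> ball 0 d" "B t = B t'" "t \<noteq> t'"
      by (auto simp: inj_on_def)
    have "extends_over bounded_separately_continuous (B t) h"
    proof (rule extends_over_scaled_difference)
      show "extends_over bounded_separately_continuous (B t) (line t)"
        "extends_over bounded_separately_continuous (B t) (line t')"
        using B(3) t by metis+
      fix w :: "complex^'n" assume "w \<in> torus"
      moreover have "complex_of_real t - of_real t' \<noteq> 0"
        using t by simp
      ultimately show "h w = 1 / (of_real t - of_real t') * (line t w - line t' w)"
        by (simp add: line_def field_simps)
    qed
    moreover have "open (B t)"
      using topological_basis_open[OF \<B>(2) B(1)[OF t(1)]] .
    ultimately show False
      using B(2)[OF t(1)] hU unfolding nowhere_extendable_def one_side_extendable_iff_extends_over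
      by blast
  qed
  then show "f \<in> Cp_topology p closure_of nowhere_extendable bounded_separately_continuous p"
    using f by (simp add: in_closure_of Bex_def)
qed

lemma nowhere_extendable_antimono:
  assumes "\<And>S F. compact S \<Longrightarrow> R S F \<Longrightarrow> R' S F"
  shows "nowhere_extendable R' p \<subseteq> nowhere_extendable R p"
proof -
  have "extends_over R' U f" if "extends_over R U f" for U f
    using that by (rule extends_over_weaken) (rule assms[OF compact_closure_Int_polydisc])
  then show ?thesis
    unfolding nowhere_extendable_def one_side_extendable_iff_extends_over by blast
qed

theorem theorem18:
  fixes p :: enat
  shows "dense_gdelta_in (Cp_topology p)
           (nowhere_extendable bounded_separately_continuous p :: (complex^'n \<Rightarrow> complex) set) \<and>
         residual_in (Cp_topology p)
           (nowhere_extendable continuous_on p :: (complex^'n \<Rightarrow> complex) set) \<and>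
         dense_gdelta_in (Cp_topology p)
           (nowhere_extendable lipschitz_continuous p :: (complex^'n \<Rightarrow> complex) set)"
proof -
  let ?X = "Cp_topology p :: (complex^'n \<Rightarrow> complex) topology"
  let ?N = "nowhere_extendable bounded_separately_continuous p :: (complex^'n \<Rightarrow> complex) set"
  let ?L = "nowhere_extendable lipschitz_continuous p :: (complex^'n \<Rightarrow> complex) set"
  have dense: "?X closure_of ?N = topspace ?X"
    by (rule dense_nowhere_extendable[OF lacunary_coord_nowhere_extendable])
  then have N: "dense_gdelta_in ?X ?N"
    by (simp add: dense_gdelta_in_def gdelta_nowhere_extendable_bounded_separately_continuous)
  have "?N \<subseteq> nowhere_extendable continuous_on p"
    by (rule nowhere_extendable_antimono)
      (rule continuous_on_compact_imp_bounded_separately_continuous)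
  then have C: "residual_in ?X (nowhere_extendable continuous_on p)"
    using N by (auto simp: residual_in_def nowhere_extendable_def)
  have "?N \<subseteq> ?L"
    by (rule nowhere_extendable_antimono)
      (auto simp: lipschitz_continuous_def
        intro: continuous_on_compact_imp_bounded_separately_continuous lipschitz_on_continuous_on)
  then have "?X closure_of ?L = topspace ?X"
    using closure_of_mono[of ?N ?L ?X] closure_of_subset_topspace[of ?X ?L] dense by simp
  then have "dense_gdelta_in ?X ?L"
    by (simp add: dense_gdelta_in_def gdelta_nowhere_extendable_lipschitz_continuous)
  with N C show ?thesis
    by blast
qed

end
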